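(* Let $I$ be an inner function in $\mathcal{D}$. Then there exists a dominant set for the large model space $K_I = H^2(\mathcal{D})\ominus I H^2(\mathcal{D})$; that is, there exists a Lebesgue measurable set $E\subset \partial_0\mathcal{D}$ with $\Sigma(E)<1$ and a constant $C>0$ such that \[ \|f\|_{H^2}^2 \le C\int_E |f|^2\,d\Sigma \quad\text{for all } f\in K_I. \]
   Context: Let $B_n$ be the open unit ball of $\mathbb{C}^n$ and $S_n=\partial B_n$. For $k\in\mathbb{N}$ and $n_1,\dots,n_k\in\mathbb{N}$, let $\mathcal{D}=B_{n_1}\times\cdots\times B_{n_k}\subset\mathbb{C}^{n_1+\dots+n_k}$, with distinguished (Shilov) boundary $\partial_0\mathcal{D}=S_{n_1}\times\cdots\times S_{n_k}$, and let $\Sigma$ be the normalized Lebesgue (surface) measure on $\partial_0\mathcal{D}$. A holomorphic function $I:\mathcal{D}\to\mathbb{D}$ (open unit disk) is called inner if its radial boundary values $I(\zeta)=\lim_{r\to1-}I(r\zeta)$ satisfy $|I(\zeta)|=1$ for $\Sigma$-a.e. $\zeta\in\partial_0\mathcal{D}$ (unimodular constants are not inner). The Hardy space $H^2=H^2(\mathcal{D})$ consists of holomorphic $f$ on $\mathcal{D}$ with $\|f\|_{H^2}^2=\sup_{0<r<1}\int_{\partial_0\mathcal{D}}|f(r\zeta)|^2\,d\Sigma(\zeta)<\infty$, identified with its boundary values in $L^2(\Sigma)$. *)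

theory Defs
  imports "HOL-Analysis.Analysis"
begin

text \<open>Coordinates of C^N are indexed by a finite type 'n; the map blk :: 'n => 'k assigns
each coordinate to one of the factors B_{n_1},...,B_{n_k} (blk surjective: every n_i >= 1).\<close>

definition blk_norm2 :: "('n::finite \<Rightarrow> 'k) \<Rightarrow> 'k \<Rightarrow> complex^'n \<Rightarrow> real" where
  "blk_norm2 blk b z = (\<Sum>j\<in>{j. blk j = b}. (cmod (z $ j))^2)"

definition prod_ball :: "('n::finite \<Rightarrow> 'k) \<Rightarrow> (complex^'n) set" where
  "prod_ball blk = {z. \<forall>b. blk_norm2 blk b z < 1}"

definition dist_bdry :: "('n::finite \<Rightarrow> 'k) \<Rightarrow> (complex^'n) set" where
  "dist_bdry blk = {z. \<forall>b. blk_norm2 blk b z = 1}"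

definition radproj :: "('n::finite \<Rightarrow> 'k) \<Rightarrow> complex^'n \<Rightarrow> complex^'n" where
  "radproj blk z = (\<chi> j. z $ j / complex_of_real (sqrt (blk_norm2 blk (blk j) z)))"

text \<open>Normalized surface measure on the distinguished boundary: the product of the normalized
surface measures sigma_{n_i} on the spheres S_{n_i}.  It is realized as the image of normalized
Lebesgue measure on D under the blockwise radial projection (polar coordinates in each factor),
and completed (Lebesgue measurable sets).\<close>
definition Sigma_bd :: "('n::finite \<Rightarrow> 'k) \<Rightarrow> (complex^'n) measure" where
  "Sigma_bd blk = completion (distr (uniform_measure lborel (prod_ball blk)) borel (radproj blk))"

definition holo_on :: "(complex^'n::finite) set \<Rightarrow> (complex^'n \<Rightarrow> complex) \<Rightarrow> bool" where
  "holo_on D f \<longleftrightarrow> (\<forall>z\<in>D. \<exists>f'. (f has_derivative f') (at z) \<and>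
                        (\<forall>(c::complex) v. f' (c *s v) = c * f' v))"

definition radial_bv :: "(complex^'n::finite \<Rightarrow> complex) \<Rightarrow> complex^'n \<Rightarrow> complex" where
  "radial_bv f \<zeta> = Lim (at_left 1) (\<lambda>r::real. f (r *\<^sub>R \<zeta>))"

definition hardy_norm2 :: "('n::finite \<Rightarrow> 'k) \<Rightarrow> (complex^'n \<Rightarrow> complex) \<Rightarrow> ennreal" where
  "hardy_norm2 blk f = (SUP r\<in>{0<..<1::real}. \<integral>\<^sup>+ \<zeta>. ennreal ((cmod (f (r *\<^sub>R \<zeta>)))^2) \<partial>Sigma_bd blk)"

definition H2 :: "('n::finite \<Rightarrow> 'k) \<Rightarrow> (complex^'n \<Rightarrow> complex) set" where
  "H2 blk = {f. holo_on (prod_ball blk) f \<and> hardy_norm2 blk f < \<infinity>}"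

text \<open>Inner product of H^2, via the identification with boundary values in L^2(Sigma).\<close>
definition H2_inner :: "('n::finite \<Rightarrow> 'k) \<Rightarrow> (complex^'n \<Rightarrow> complex) \<Rightarrow> (complex^'n \<Rightarrow> complex) \<Rightarrow> complex" where
  "H2_inner blk f g = (\<integral> \<zeta>. radial_bv f \<zeta> * cnj (radial_bv g \<zeta>) \<partial>Sigma_bd blk)"

definition inner_fun :: "('n::finite \<Rightarrow> 'k) \<Rightarrow> (complex^'n \<Rightarrow> complex) \<Rightarrow> bool" where
  "inner_fun blk I \<longleftrightarrow> holo_on (prod_ball blk) I \<and> (\<forall>z\<in>prod_ball blk. cmod (I z) < 1) \<and>
     (AE \<zeta> in Sigma_bd blk. \<exists>w. ((\<lambda>r::real. I (r *\<^sub>R \<zeta>)) \<longlongrightarrow> w) (at_left 1) \<and> cmod w = 1)"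

definition model_space :: "('n::finite \<Rightarrow> 'k) \<Rightarrow> (complex^'n \<Rightarrow> complex) \<Rightarrow> (complex^'n \<Rightarrow> complex) set" where
  "model_space blk I = {f \<in> H2 blk. \<forall>g \<in> H2 blk. H2_inner blk f (\<lambda>z. I z * g z) = 0}"

end

theory Submission
  imports Defs "HOL-Complex_Analysis.Complex_Analysis"
begin

text \<open>
  If \<open>f\<close> is in the model space, then \<open>f\<close> is orthogonal to \<open>I f\<close>, so \<open>\<integral> |f|\<^sup>2 I d\<Sigma> = 0\<close> on the
  distinguished boundary. For a unimodular constant \<open>c\<close> put \<open>E = {Re (c I) \<ge> -1/2}\<close>. Off \<open>E\<close> one has
  \<open>Re (c I) < -1/2\<close>, while \<open>Re (c I) \<le> 1\<close> on \<open>E\<close>, so \<open>1 \<le> 3 \<cdot> 1\<^sub>E - 2 Re (c I)\<close> everywhere, and integrating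
  against \<open>|f|\<^sup>2\<close> gives \<open>\<parallel>f\<parallel>\<^sup>2 \<le> 3 \<integral>\<^sub>E |f|\<^sup>2\<close>. As \<open>|I| = 1\<close> almost everywhere, \<open>E\<close> cannot have full measure
  for all four of \<open>c = 1, -1, i, -i\<close>.

  The analytic input is that every \<open>f\<close> in \<open>H\<^sup>2\<close> has radial limits almost everywhere, and that these determine
  its norm. The measure \<open>\<Sigma>\<close> is invariant under \<open>\<zeta> \<mapsto> e\<^sup>i\<^sup>t \<zeta>\<close>, so this reduces to the slices
  \<open>\<lambda> \<mapsto> f (\<lambda> \<zeta>)\<close> in the Hardy space of the disc. There it follows from an \<open>L\<^sup>2\<close> bound for the radial
  maximal function, which the \<open>T T\<^sup>*\<close> method derives from the semigroup law \<open>P\<^sub>r * P\<^sub>s = P\<^sub>r\<^sub>s\<close> of the Poisson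
  kernels and the inequality \<open>P\<^sub>r\<^sub>s \<le> 8 (P\<^sub>r + P\<^sub>s)\<close>.
\<close>

section \<open>The T T* method for positive kernels\<close>

lemma ennreal_power2_le_imp_le:
  fixes a b :: ennreal
  assumes "a\<^sup>2 \<le> b\<^sup>2"
  shows "a \<le> b"
proof (rule ccontr)
  assume "\<not> a \<le> b"
  then have "b < a" by simp
  then obtain b' where b: "b = ennreal b'" "0 \<le> b'" by (cases b) auto
  show False
  proof (cases a)
    case top
    then show False using assms b by (simp add: ennreal_power top_unique)
  next
    case (real a')
    then have "a'\<^sup>2 \<le> b'\<^sup>2" using assms b by (simp add: ennreal_power)
    then have "a' \<le> b'" using b(2) by (rule power2_le_imp_le)
    then show False using \<open>b < a\<close> real b by (simp add: ennreal_leI leD)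
  qed
qed

text \<open>Write \<open>g = T u\<close> and let \<open>T'\<close> be the transpose of
  \<open>T\<close> applied to \<open>g\<close>. Tonelli and Cauchy-Schwarz give
  \<open>(N g)^2 \<le> N u * N T'\<close>. Expanding the square, \<open>N T'\<close> is the
  quadratic form of the kernel of \<open>T\<close> composed with its transpose, which
  \<open>kk\<close> dominates by the symmetrized kernel of \<open>T\<close>. Hence
  \<open>N T'\<close> is at most \<open>2 * C\<close> times the pairing of \<open>g\<close> with
  \<open>T g\<close>, and the known bound \<open>A\<close> controls that pairing by
  \<open>sqrt A * N g\<close>.\<close>

lemma TTstar_improve:
  fixes k :: "'a \<Rightarrow> 'a \<Rightarrow> ennreal" and M :: "'a measure"
  defines "T \<equiv> \<lambda>u x. \<integral>\<^sup>+y. k x y * u y \<partial>M"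
  defines "N \<equiv> \<lambda>u :: 'a \<Rightarrow> ennreal. \<integral>\<^sup>+x. (u x)\<^sup>2 \<partial>M"
  assumes "finite_measure M"
    and k[measurable]: "(\<lambda>(x, y). k x y) \<in> borel_measurable (M \<Otimes>\<^sub>M M)"
    and kk: "\<And>x z. x \<in> space M \<Longrightarrow> z \<in> space M \<Longrightarrow>
               (\<integral>\<^sup>+y. k x y * k z y \<partial>M) \<le> ennreal C * (k x z + k z x)"
    and "0 \<le> A" and A: "\<And>u. u \<in> borel_measurable M \<Longrightarrow> N u < \<infinity> \<Longrightarrow> N (T u) \<le> ennreal A * N u"
    and u[measurable]: "u \<in> borel_measurable M" and Nu: "N u < \<infinity>"
    and "0 \<le> C"
  shows "N (T u) \<le> ennreal (2 * C * sqrt A) * N u"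
proof -
  interpret finite_measure M by fact
  interpret P: pair_sigma_finite M M ..
  have km[measurable (raw)]: "x \<in> space M \<Longrightarrow> k x \<in> borel_measurable M" for x
    by measurable
  have km'[measurable (raw)]: "y \<in> space M \<Longrightarrow> (\<lambda>x. k x y) \<in> borel_measurable M" for y
    by measurable
  define g where "g = T u"
  have g[measurable]: "g \<in> borel_measurable M"
    unfolding g_def T_def by measurable
  \<comment> \<open>Finiteness allows the bound \<open>A\<close> to be applied to \<open>g\<close>
    itself and a factor \<open>N g\<close> to be cancelled at the end.\<close>
  have Ng: "N g < \<infinity>"
    unfolding g_def using A[OF u Nu] by (rule le_less_trans) (use Nu in \<open>simp add: ennreal_mult_less_top\<close>)
  define T' where "T' = (\<lambda>y. \<integral>\<^sup>+x. k x y * g x \<partial>M)"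
  have [measurable]: "T' \<in> borel_measurable M"
    unfolding T'_def by measurable
  have "N g = (\<integral>\<^sup>+x. g x * T u x \<partial>M)"
    unfolding N_def power2_eq_square by (simp add: g_def)
  also have "\<dots> = (\<integral>\<^sup>+x. (\<integral>\<^sup>+y. g x * (k x y * u y) \<partial>M) \<partial>M)"
    unfolding T_def by (intro nn_integral_cong nn_integral_cmult[symmetric]) measurable
  also have "\<dots> = (\<integral>\<^sup>+y. (\<integral>\<^sup>+x. g x * (k x y * u y) \<partial>M) \<partial>M)"
    by (rule P.Fubini') measurable
  also have "\<dots> = (\<integral>\<^sup>+y. u y * T' y \<partial>M)"
  proof (rule nn_integral_cong)
    fix y assume y: "y \<in> space M"
    have "u y * T' y = (\<integral>\<^sup>+x. u y * (k x y * g x) \<partial>M)"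
      unfolding T'_def using y by (intro nn_integral_cmult[symmetric]) measurable
    then show "(\<integral>\<^sup>+x. g x * (k x y * u y) \<partial>M) = u y * T' y"
      by (simp only: mult_ac)
  qed
  finally have "(N g)\<^sup>2 \<le> N u * N T'"
    unfolding N_def using Cauchy_Schwarz_nn_integral[of u M T'] by simp
  also have "N T' \<le> ennreal (2 * C) * (\<integral>\<^sup>+x. g x * T g x \<partial>M)"
  proof -
    have "N T' = (\<integral>\<^sup>+y. (\<integral>\<^sup>+x. (\<integral>\<^sup>+z. (g x * g z) * (k x y * k z y) \<partial>M) \<partial>M) \<partial>M)"
      unfolding N_def power2_eq_square
    proof (rule nn_integral_cong)
      fix y assume y: "y \<in> space M"
      have "T' y * T' y = (\<integral>\<^sup>+x. k x y * g x * T' y \<partial>M)"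
        using y by (subst nn_integral_multc) (auto simp: T'_def)
      also have "\<dots> = (\<integral>\<^sup>+x. \<integral>\<^sup>+z. k x y * g x * (k z y * g z) \<partial>M \<partial>M)"
        using y by (subst nn_integral_cmult) (auto simp: T'_def)
      finally show "T' y * T' y = (\<integral>\<^sup>+x. (\<integral>\<^sup>+z. (g x * g z) * (k x y * k z y) \<partial>M) \<partial>M)"
        by (simp only: mult_ac)
    qed
    also have "\<dots> = (\<integral>\<^sup>+x. (\<integral>\<^sup>+y. (\<integral>\<^sup>+z. (g x * g z) * (k x y * k z y) \<partial>M) \<partial>M) \<partial>M)"
      by (rule P.Fubini') measurable
    also have "\<dots> = (\<integral>\<^sup>+x. (\<integral>\<^sup>+z. (\<integral>\<^sup>+y. (g x * g z) * (k x y * k z y) \<partial>M) \<partial>M) \<partial>M)"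
      by (intro nn_integral_cong P.Fubini') measurable
    also have "\<dots> = (\<integral>\<^sup>+x. (\<integral>\<^sup>+z. (g x * g z) * (\<integral>\<^sup>+y. (k x y * k z y) \<partial>M) \<partial>M) \<partial>M)"
      by (intro nn_integral_cong) (simp add: nn_integral_cmult)
    also have "\<dots> \<le> (\<integral>\<^sup>+x. (\<integral>\<^sup>+z. (g x * g z) * (ennreal C * (k x z + k z x)) \<partial>M) \<partial>M)"
      by (intro nn_integral_mono mult_left_mono kk) auto
    also have "\<dots> = ennreal C * (\<integral>\<^sup>+x. (\<integral>\<^sup>+z. (g x * g z) * (k x z + k z x) \<partial>M) \<partial>M)"
    proof -
      have "(\<integral>\<^sup>+z. (g x * g z) * (ennreal C * (k x z + k z x)) \<partial>M)
          = ennreal C * (\<integral>\<^sup>+z. (g x * g z) * (k x z + k z x) \<partial>M)" if "x \<in> space M" for x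
        using that by (subst nn_integral_cmult[symmetric]) (auto simp: mult_ac)
      then show ?thesis
        by (subst nn_integral_cmult[symmetric]) (auto cong: nn_integral_cong)
    qed
    also have "(\<integral>\<^sup>+x. (\<integral>\<^sup>+z. (g x * g z) * (k x z + k z x) \<partial>M) \<partial>M)
       = (\<integral>\<^sup>+x. (\<integral>\<^sup>+z. (g x * g z) * k x z \<partial>M) \<partial>M) + (\<integral>\<^sup>+x. (\<integral>\<^sup>+z. (g x * g z) * k z x \<partial>M) \<partial>M)"
      by (simp add: distrib_left nn_integral_add cong: nn_integral_cong)
    also have "(\<integral>\<^sup>+x. (\<integral>\<^sup>+z. (g x * g z) * k z x \<partial>M) \<partial>M) = (\<integral>\<^sup>+z. (\<integral>\<^sup>+x. (g x * g z) * k z x \<partial>M) \<partial>M)"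
      by (rule P.Fubini') measurable
    also have "\<dots> = (\<integral>\<^sup>+x. g x * T g x \<partial>M)"
      unfolding T_def by (intro nn_integral_cong) (subst nn_integral_cmult[symmetric], auto simp: mult_ac)
    also have "(\<integral>\<^sup>+x. (\<integral>\<^sup>+z. (g x * g z) * k x z \<partial>M) \<partial>M) = (\<integral>\<^sup>+x. g x * T g x \<partial>M)"
      unfolding T_def by (intro nn_integral_cong) (subst nn_integral_cmult[symmetric], auto simp: mult_ac)
    finally show ?thesis
      using \<open>0 \<le> C\<close> by (simp only: ennreal_mult zero_le_numeral mult_2[symmetric] ennreal_numeral mult_ac)
  qed
  also have "(\<integral>\<^sup>+x. g x * T g x \<partial>M) \<le> ennreal (sqrt A) * N g"
  proof -
    have [measurable]: "T g \<in> borel_measurable M"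
      unfolding T_def by measurable
    have "(\<integral>\<^sup>+x. g x * T g x \<partial>M)\<^sup>2 \<le> N g * N (T g)"
      unfolding N_def by (rule Cauchy_Schwarz_nn_integral) auto
    also have "\<dots> \<le> N g * (ennreal A * N g)"
      by (intro mult_left_mono A Ng) auto
    also have "\<dots> = (ennreal (sqrt A) * N g)\<^sup>2"
      using \<open>0 \<le> A\<close> by (simp add: power_mult_distrib ennreal_power) (simp add: power2_eq_square mult.left_commute)
    finally show ?thesis by (rule ennreal_power2_le_imp_le)
  qed
  finally have "(N g)\<^sup>2 \<le> N u * (ennreal (2 * C) * (ennreal (sqrt A) * N g))"
    by (simp add: mult_left_mono)
  also have "\<dots> = N g * (ennreal (2 * C * sqrt A) * N u)"
    using \<open>0 \<le> C\<close> \<open>0 \<le> A\<close> by (simp only: ennreal_mult real_sqrt_ge_zero mult_nonneg_nonneg zero_le_numeral mult_ac)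
  finally have "N g * N g \<le> N g * (ennreal (2 * C * sqrt A) * N u)"
    by (simp only: power2_eq_square)
  then show ?thesis
    using Ng by (cases "N g = 0") (simp_all add: g_def ennreal_mult_le_mult_iff less_top)
qed

text \<open>The boundedness of \<open>k\<close> only provides some finite bound for the operator; the infimum \<open>A\<close> of all
  admissible bounds then satisfies \<open>A \<le> 2 C sqrt A\<close>.\<close>
lemma TTstar:
  fixes k :: "'a \<Rightarrow> 'a \<Rightarrow> ennreal" and M :: "'a measure"
  assumes "finite_measure M"
    and k[measurable]: "(\<lambda>(x, y). k x y) \<in> borel_measurable (M \<Otimes>\<^sub>M M)"
    and kB: "\<And>x y. x \<in> space M \<Longrightarrow> y \<in> space M \<Longrightarrow> k x y \<le> ennreal B"
    and kk: "\<And>x z. x \<in> space M \<Longrightarrow> z \<in> space M \<Longrightarrow>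
               (\<integral>\<^sup>+y. k x y * k z y \<partial>M) \<le> ennreal C * (k x z + k z x)"
    and "0 < C"
    and u[measurable]: "u \<in> borel_measurable M"
  shows "(\<integral>\<^sup>+x. (\<integral>\<^sup>+y. k x y * u y \<partial>M)\<^sup>2 \<partial>M) \<le> ennreal (4 * C\<^sup>2) * (\<integral>\<^sup>+x. (u x)\<^sup>2 \<partial>M)"
proof -
  interpret finite_measure M by fact
  define T where "T = (\<lambda>u x. \<integral>\<^sup>+y. k x y * u y \<partial>M)"
  define N where "N = (\<lambda>u :: 'a \<Rightarrow> ennreal. \<integral>\<^sup>+x. (u x)\<^sup>2 \<partial>M)"
  define V where "V = {A. 0 \<le> A \<and> (\<forall>u \<in> borel_measurable M. N u < \<infinity> \<longrightarrow> N (T u) \<le> ennreal A * N u)}"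
  define m where "m = measure M (space M)"
  have m: "emeasure M (space M) = ennreal m" "0 \<le> m"
    by (simp_all add: m_def emeasure_eq_measure)
  have improve: "2 * C * sqrt A \<in> V" if "A \<in> V" for A
    using that TTstar_improve[OF \<open>finite_measure M\<close> k kk, of A] \<open>0 < C\<close>
    by (auto simp: V_def T_def N_def)
  \<comment> \<open>A Hilbert-Schmidt type bound by Cauchy-Schwarz, where \<open>m\<close> is the
    total mass; it shows that \<open>V\<close> is nonempty.\<close>
  have "B\<^sup>2 * m * m \<in> V"
  proof -
    have "N (T v) \<le> ennreal (B\<^sup>2 * m * m) * N v" if v[measurable]: "v \<in> borel_measurable M" for v
    proof -
      have "N (T v) \<le> (\<integral>\<^sup>+x. ennreal (B\<^sup>2 * m) * N v \<partial>M)"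
        unfolding N_def
      proof (rule nn_integral_mono)
        fix x assume x: "x \<in> space M"
        then have [measurable]: "(\<lambda>y. k x y) \<in> borel_measurable M" by measurable
        have "(T v x)\<^sup>2 \<le> (\<integral>\<^sup>+y. (k x y)\<^sup>2 \<partial>M) * (\<integral>\<^sup>+x. (v x)\<^sup>2 \<partial>M)"
          unfolding T_def by (rule Cauchy_Schwarz_nn_integral) auto
        also have "(\<integral>\<^sup>+y. (k x y)\<^sup>2 \<partial>M) \<le> (\<integral>\<^sup>+y. (ennreal \<bar>B\<bar>)\<^sup>2 \<partial>M)"
          using x by (intro nn_integral_mono power_mono order_trans[OF kB]) (auto simp: ennreal_leI)
        also have "\<dots> = ennreal (B\<^sup>2 * m)"
          using m by (simp add: ennreal_power ennreal_mult)
        finally show "(T v x)\<^sup>2 \<le> ennreal (B\<^sup>2 * m) * (\<integral>\<^sup>+x. (v x)\<^sup>2 \<partial>M)"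
          by (simp add: mult_right_mono)
      qed
      then show ?thesis
        using m by (simp add: ennreal_mult mult_ac)
    qed
    then show ?thesis using m by (auto simp: V_def)
  qed
  then have V: "V \<noteq> {}" "bdd_below V" by (auto simp: V_def intro!: bdd_belowI[of _ 0])
  define A where "A = Inf V"
  \<comment> \<open>The infimum is attained: for fixed \<open>v\<close> with finite
    \<open>N v\<close> both sides are finite, and the inequality is closed in the constant.\<close>
  have "A \<in> V"
  proof -
    have "0 \<le> A" unfolding A_def using V by (intro cInf_greatest) (auto simp: V_def)
    moreover have "N (T v) \<le> ennreal A * N v" if v: "v \<in> borel_measurable M" "N v < \<infinity>" for v
    proof -
      obtain n where n: "N v = ennreal n" "0 \<le> n" using v(2) by (cases "N v") auto
      obtain B where "B \<in> V" using V by auto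
      then have "N (T v) \<le> ennreal B * N v" using v by (auto simp: V_def)
      then obtain t where t: "N (T v) = ennreal t" "0 \<le> t"
        using n by (cases "N (T v)") (auto simp: top_unique ennreal_mult_eq_top_iff)
      have "t \<le> x * n" if "x \<in> V" for x
        using that v n t by (auto simp: V_def simp flip: ennreal_mult)
      have "t \<le> A * n"
      proof (cases "n = 0")
        case True then show ?thesis using \<open>\<And>x. x \<in> V \<Longrightarrow> t \<le> x * n\<close> \<open>B \<in> V\<close> by auto
      next
        case False
        then have "t / n \<le> A" unfolding A_def
          using V \<open>\<And>x. x \<in> V \<Longrightarrow> t \<le> x * n\<close> n by (intro cInf_greatest) (auto simp: divide_simps)
        then show ?thesis using False n by (auto simp: divide_simps)
      qed
      then show ?thesis using n t \<open>0 \<le> A\<close> by (simp flip: ennreal_mult)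
    qed
    ultimately show ?thesis by (auto simp: V_def)
  qed
  then have "A \<le> 2 * C * sqrt A" "0 \<le> A"
    using improve V unfolding A_def by (auto intro!: cInf_lower simp: V_def)
  have "sqrt A \<le> 2 * C"
  proof (cases "A = 0")
    case False
    have "sqrt A * sqrt A \<le> 2 * C * sqrt A" using \<open>A \<le> 2 * C * sqrt A\<close> \<open>0 \<le> A\<close> by simp
    then show ?thesis using False \<open>0 \<le> A\<close> by (intro mult_right_le_imp_le[of "sqrt A" "sqrt A" "2 * C"]) auto
  qed (use \<open>0 < C\<close> in simp)
  then have A_le: "A \<le> 4 * C\<^sup>2"
    using power_mono[of "sqrt A" "2 * C" 2] \<open>0 \<le> A\<close> by (simp add: power_mult_distrib)
  have "N (T u) \<le> ennreal (4 * C\<^sup>2) * N u"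
  proof (cases "N u < \<infinity>")
    case True
    then have "N (T u) \<le> ennreal A * N u" using \<open>A \<in> V\<close> by (auto simp: V_def)
    also have "\<dots> \<le> ennreal (4 * C\<^sup>2) * N u" by (intro mult_right_mono ennreal_leI A_le) auto
    finally show ?thesis .
  next
    case False
    then show ?thesis using \<open>0 < C\<close> by (simp add: less_top[symmetric] ennreal_mult_top)
  qed
  then show ?thesis unfolding N_def T_def .
qed

section \<open>Rotation invariance of Lebesgue measure\<close>

lemma lborel_translate:
  fixes a :: "'a::euclidean_space"
  shows "distr lborel borel (\<lambda>x. a + x) = lborel"
  using lborel_affine[of 1 a] by (simp add: density_1)

text \<open>Uniqueness of Haar measure: Tonelli applied to \<open>1\<^sub>A(x) 1\<^sub>B(y - x)\<close>, with \<open>B\<close> the unit ball,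
  compares the translation-invariant image measure with Lebesgue measure.\<close>
lemma lborel_distr_linear_isometry:
  fixes L :: "'a::euclidean_space \<Rightarrow> 'a"
  assumes lin: "linear L" and nrm: "\<And>x. norm (L x) = norm x" and "surj L"
  shows "distr lborel borel L = lborel"
proof -
  have [measurable]: "L \<in> borel_measurable borel"
    using lin by (intro borel_measurable_continuous_onI linear_continuous_on linear_conv_bounded_linear[THEN iffD1])
  define \<nu> where "\<nu> = distr lborel borel L"
  define U where "U = ball (0::'a) 1"
  have [measurable]: "U \<in> sets borel" by (auto simp: U_def)
  have sets\<nu>[measurable_cong, simp]: "sets \<nu> = sets borel" by (auto simp: \<nu>_def)
  have [simp]: "space \<nu> = UNIV" by (simp add: \<nu>_def)
  \<comment> \<open>Translating the image measure by \<open>a = L b\<close> is the same as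
    translating by \<open>b\<close> before applying \<open>L\<close>; surjectivity of
    \<open>L\<close> provides \<open>b\<close>.\<close>
  have tr: "distr \<nu> borel (\<lambda>x. a + x) = \<nu>" for a
  proof -
    obtain b where b: "a = L b" using \<open>surj L\<close> by (auto simp: surj_def)
    have "distr \<nu> borel (\<lambda>x. a + x) = distr lborel borel (\<lambda>x. L (b + x))"
      unfolding \<nu>_def b by (subst distr_distr) (auto simp: o_def linear_add[OF lin])
    also have "\<dots> = distr (distr lborel borel (\<lambda>x. b + x)) borel L"
      by (subst distr_distr) (auto simp: o_def)
    finally show ?thesis by (simp add: lborel_translate \<nu>_def)
  qed
  have [simp]: "L x \<in> U \<longleftrightarrow> x \<in> U" for x by (simp add: U_def nrm)
  \<comment> \<open>The unit ball is its own preimage, which fixes the proportionality factor of the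
    two invariant measures as 1.\<close>
  have \<nu>U: "emeasure \<nu> U = emeasure lborel U"
    unfolding \<nu>_def by (subst emeasure_distr) (auto simp: vimage_def)
  have U: "0 < emeasure lborel U" "emeasure lborel U < \<infinity>"
  proof -
    show "emeasure lborel U < \<infinity>" unfolding U_def by (rule emeasure_lborel_ball_finite)
    have "emeasure lborel U \<noteq> 0"
      by (auto simp: U_def emeasure_ball less_imp_neq[OF unit_ball_vol_pos, symmetric])
    then show "0 < emeasure lborel U" by (simp add: zero_less_iff_neq_zero)
  qed
  have "sigma_finite_measure \<nu>"
  proof
    show "\<exists>A. countable A \<and> A \<subseteq> sets \<nu> \<and> \<Union> A = space \<nu> \<and> (\<forall>a\<in>A. emeasure \<nu> a \<noteq> \<infinity>)"
    proof (intro exI conjI ballI)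
      show "countable (range (\<lambda>n::nat. ball (0::'a) (real n)))" by simp
      show "range (\<lambda>n::nat. ball (0::'a) (real n)) \<subseteq> sets \<nu>" by (auto simp: \<nu>_def)
      show "\<Union> (range (\<lambda>n::nat. ball (0::'a) (real n))) = space \<nu>"
        by (auto simp: reals_Archimedean2)
      fix a assume "a \<in> range (\<lambda>n::nat. ball (0::'a) (real n))"
      then obtain n where a: "a = ball 0 (real n)" by auto
      have "emeasure \<nu> a = emeasure lborel (ball (0::'a) (real n))"
        unfolding \<nu>_def a by (subst emeasure_distr) (auto simp: vimage_def nrm ball_def)
      then show "emeasure \<nu> a \<noteq> \<infinity>" using emeasure_lborel_ball_finite[of "0::'a" "real n"] by simp
    qed
  qed
  then interpret P: pair_sigma_finite \<nu> lborel by (simp add: pair_sigma_finite_def sigma_finite_lborel)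
  interpret S: pair_sigma_finite lborel \<nu> ..
  show ?thesis
  proof (rule measure_eqI)
    fix A assume "A \<in> sets (distr lborel borel L)"
    then have [measurable]: "A \<in> sets borel" by simp
    have "emeasure \<nu> A * emeasure lborel U = (\<integral>\<^sup>+x. \<integral>\<^sup>+y. indicator A x * indicator U y \<partial>lborel \<partial>\<nu>)"
      by (simp add: nn_integral_cmult nn_integral_multc)
    also have "\<dots> = (\<integral>\<^sup>+x. \<integral>\<^sup>+y. indicator A x * indicator U (- x + y) \<partial>lborel \<partial>\<nu>)"
    proof (rule nn_integral_cong)
      fix x
      show "(\<integral>\<^sup>+y. indicator A x * indicator U y \<partial>lborel) = (\<integral>\<^sup>+y. indicator A x * indicator U (- x + y) \<partial>lborel)"
        by (subst lborel_translate[of "-x", symmetric], subst nn_integral_distr) auto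
    qed
    also have "\<dots> = (\<integral>\<^sup>+y. \<integral>\<^sup>+x. indicator A x * indicator U (- x + y) \<partial>\<nu> \<partial>lborel)"
      by (rule P.Fubini'[symmetric]) measurable
    also have "\<dots> = (\<integral>\<^sup>+y. \<integral>\<^sup>+x. indicator A (y + x) * indicator U x \<partial>\<nu> \<partial>lborel)"
    proof (rule nn_integral_cong)
      fix y :: 'a
      \<comment> \<open>Translation by \<open>y\<close> leaves \<open>U\<close> evaluated at
        \<open>- x\<close>; the symmetry of the ball then removes the sign.\<close>
      have "(\<integral>\<^sup>+x. indicator A x * indicator U (- x + y) \<partial>\<nu>) = (\<integral>\<^sup>+x. indicator A (y + x) * indicator U (- x) \<partial>\<nu> :: ennreal)"
        by (subst tr[of y, symmetric], subst nn_integral_distr) auto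
      then show "(\<integral>\<^sup>+x. indicator A x * indicator U (- x + y) \<partial>\<nu>) = (\<integral>\<^sup>+x. indicator A (y + x) * indicator U x \<partial>\<nu> :: ennreal)"
        by (simp add: indicator_def U_def cong: nn_integral_cong)
    qed
    also have "\<dots> = (\<integral>\<^sup>+x. \<integral>\<^sup>+y. indicator A (y + x) * indicator U x \<partial>lborel \<partial>\<nu>)"
      by (rule P.Fubini') measurable
    also have "\<dots> = (\<integral>\<^sup>+x. emeasure lborel A * indicator U x \<partial>\<nu>)"
    proof (rule nn_integral_cong)
      fix x
      have "(\<integral>\<^sup>+y. indicator A (y + x) \<partial>lborel) = (\<integral>\<^sup>+y. indicator A y \<partial>lborel :: ennreal)"
        by (subst (2) lborel_translate[of "x", symmetric], subst nn_integral_distr) (auto simp: add.commute)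
      then show "(\<integral>\<^sup>+y. indicator A (y + x) * indicator U x \<partial>lborel) = emeasure lborel A * indicator U x"
        by (simp add: nn_integral_multc)
    qed
    also have "\<dots> = emeasure lborel A * emeasure lborel U"
      by (simp add: nn_integral_cmult \<nu>U)
    finally have "emeasure \<nu> A = emeasure lborel A"
      using U by (auto simp: ennreal_mult_cancel_left mult.commute[of _ "emeasure lborel U"])
    then show "emeasure (distr lborel borel L) A = emeasure lborel A" unfolding \<nu>_def .
  qed simp
qed

section \<open>Poisson kernel of the disc\<close>

definition ecirc :: "real \<Rightarrow> complex" where
  "ecirc t = cis (2 * pi * t)"

text \<open>Being a density on the whole line, and not a restriction to the interval, this measure
  has the full line as its space and the Borel sets as its sets, so measurability carries over
  directly.\<close>

definition unif01 :: "real measure" where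
  "unif01 = density lborel (\<lambda>t. ennreal (indicator {0..1} t))"

definition poisson :: "complex \<Rightarrow> complex \<Rightarrow> real" where
  "poisson z w = (1 - (cmod z)\<^sup>2) / (cmod (w - z))\<^sup>2"

lemma norm_ecirc [simp]: "cmod (ecirc t) = 1"
  by (simp add: ecirc_def)

lemma ecirc_mult_cnj [simp]: "ecirc t * cnj (ecirc t) = 1" "cnj (ecirc t) * ecirc t = 1"
  by (simp_all add: ecirc_def cis_mult cis_cnj)

lemma ecirc_nonzero [simp]: "ecirc t \<noteq> 0"
  by (simp add: ecirc_def)

lemma continuous_on_ecirc [continuous_intros]:
  "continuous_on A f \<Longrightarrow> continuous_on A (\<lambda>t. ecirc (f t))"
  unfolding ecirc_def by (intro continuous_intros)

lemma ecirc_measurable [measurable]: "ecirc \<in> borel_measurable borel"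
  by (intro borel_measurable_continuous_onI continuous_intros)

lemma ecirc_exp: "ecirc t = exp (2 * complex_of_real pi * \<i> * complex_of_real t)"
  by (simp add: ecirc_def cis_conv_exp mult_ac)

lemma space_unif01 [simp]: "space unif01 = UNIV"
  and sets_unif01 [simp, measurable_cong]: "sets unif01 = sets borel"
  by (simp_all add: unif01_def)

lemma emeasure_unif01_UNIV [simp]: "emeasure unif01 UNIV = 1"
  by (simp add: unif01_def emeasure_density ennreal_indicator)

interpretation unif01: finite_measure unif01
  by standard simp

text \<open>Transfers gauge integrals over the unit interval, as contour integration and the
  fundamental theorem of calculus deliver them, to the Lebesgue integral.\<close>

lemma has_bochner_integral_unif01:
  fixes f :: "real \<Rightarrow> 'a::euclidean_space"
  assumes f: "continuous_on UNIV f" and I: "(f has_integral I) {0..1}"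
  shows "has_bochner_integral unif01 f I"
proof -
  have [measurable]: "f \<in> borel_measurable borel"
    using f by (rule borel_measurable_continuous_onI)
  have *: "set_integrable lborel {0..1} f"
    using f by (intro borel_integrable_atLeastAtMost') (rule continuous_on_subset, auto)
  then have "(LINT x:{0..1}|lborel. f x) = I"
    using I set_borel_integral_eq_integral(2)[OF *] by (simp add: integral_unique)
  then show ?thesis
    using * unfolding set_integrable_def set_lebesgue_integral_def unif01_def
    by (auto simp: has_bochner_integral_iff integrable_density integral_density)
qed

lemma poisson_nonneg: "cmod z < 1 \<Longrightarrow> 0 \<le> poisson z w"
  by (simp add: poisson_def power_le_one)

text \<open>Cauchy's formula at \<open>z\<close>, applied to \<open>f w (1 - |z|\<^sup>2) / (1 - cnj z w)\<close>.\<close>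
lemma poisson_integral:
  assumes f: "f holomorphic_on ball 0 R" and "1 < R" and z: "cmod z < 1"
  shows "((\<lambda>t. f (ecirc t) * complex_of_real (poisson z (ecirc t))) has_integral f z) {0..1}"
proof -
  define F where "F = (\<lambda>w. f w * (1 - (cmod z)\<^sup>2) / (1 - cnj z * w))"
  have nz: "1 - cnj z * w \<noteq> 0" if "cmod w \<le> 1" for w
  proof
    assume "1 - cnj z * w = 0"
    then have "cmod (cnj z * w) = 1" by simp
    moreover have "cmod z * cmod w \<le> cmod z * 1" using that by (intro mult_left_mono) auto
    ultimately show False using z by (simp add: norm_mult)
  qed
  have "F holomorphic_on cball 0 1"
    unfolding F_def using nz \<open>1 < R\<close>
    by (intro holomorphic_intros holomorphic_on_subset[OF f]) auto
  then have "((\<lambda>u. F u / (u - z)) has_contour_integral (2 * of_real pi * \<i> * F z)) (circlepath 0 1)"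
    using z by (intro Cauchy_integral_circlepath holomorphic_on_imp_continuous_on)
      (auto intro: holomorphic_on_subset)
  then have *: "((\<lambda>t. F (ecirc t) / (ecirc t - z) * (2 * of_real pi * \<i> * ecirc t)) has_integral
                2 * of_real pi * \<i> * F z) {0..1}"
  proof -
    have "circlepath 0 1 t = ecirc t" for t
      by (simp add: circlepath ecirc_exp)
    moreover have "vector_derivative (circlepath 0 1) (at t within {0..1}) = 2 * of_real pi * \<i> * ecirc t"
      if "t \<in> {0..1}" for t
      using that by (simp add: vector_derivative_circlepath01 ecirc_exp)
    ultimately show ?thesis
      using \<open>((\<lambda>u. F u / (u - z)) has_contour_integral _) _\<close>
      unfolding has_contour_integral_def by (auto elim!: has_integral_eq[rotated])
  qed
  have "F z = f z"
  proof -
    have "1 - cnj z * z = 1 - complex_of_real ((cmod z)\<^sup>2)"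
      by (simp only: complex_norm_square mult.commute)
    then show ?thesis using nz[of z] z by (simp add: F_def)
  qed
  moreover have "F (ecirc t) / (ecirc t - z) * (2 * of_real pi * \<i> * ecirc t)
     = 2 * of_real pi * \<i> * (f (ecirc t) * complex_of_real (poisson z (ecirc t)))" for t
  proof -
    \<comment> \<open>On the circle the denominator added in \<open>F\<close> is the conjugate of
      the Cauchy denominator up to the factor \<open>ecirc t\<close>; their product is a squared
      modulus, and the extra factor cancels the one from the derivative of the path.\<close>
    have "1 - cnj z * ecirc t = ecirc t * cnj (ecirc t - z)"
      by (simp add: algebra_simps)
    moreover have "ecirc t - z \<noteq> 0" using z by auto
    moreover have "(complex_of_real (cmod (ecirc t - z)))\<^sup>2 = (ecirc t - z) * cnj (ecirc t - z)"
      by (metis complex_norm_square of_real_power)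
    ultimately show ?thesis
      by (simp add: F_def poisson_def mult_ac del: complex_cnj_diff)
  qed
  ultimately have "((\<lambda>t. 2 * of_real pi * \<i> * (f (ecirc t) * complex_of_real (poisson z (ecirc t)))) has_integral
                2 * of_real pi * \<i> * f z) {0..1}"
    using * by simp
  from has_integral_mult_right[OF this, of "1 / (2 * of_real pi * \<i>)"] show ?thesis
    by simp
qed

section \<open>Algebra of the Poisson kernel: real part formula, symmetry, semigroup law\<close>

lemma Re_cayley: "Re ((1 + q) / (1 - q)) = (1 - (cmod q)\<^sup>2) / (cmod (1 - q))\<^sup>2"
  unfolding Re_divide cmod_power2 by (simp add: power2_eq_square algebra_simps)

text \<open>Exhibits the kernel as the real part of a function holomorphic in \<open>z\<close>, so
  that the Poisson formula can be applied to the kernel itself.\<close>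

lemma Re_cayley_poisson:
  assumes "cmod z < 1" "cmod w = 1"
  shows "Re ((1 + z * cnj w) / (1 - z * cnj w)) = poisson z w"
proof -
  have "w * cnj w = 1" using assms(2) by (metis complex_norm_square of_real_1 one_power2)
  then have "w - z = w * (1 - z * cnj w)" by (simp add: algebra_simps)
  then have "cmod (w - z) = cmod (1 - z * cnj w)" using assms(2) by (simp only: norm_mult)
  then show ?thesis using assms by (simp add: Re_cayley poisson_def norm_mult)
qed

lemma cmod_circle_diff_swap:
  assumes "cmod w = 1" "cmod v = 1"
  shows "cmod (w - of_real r * v) = cmod (v - of_real r * w)"
proof -
  have "w * cnj w = 1" "v * cnj v = 1" using assms by (metis complex_norm_square of_real_1 one_power2)+
  moreover have "w * v * cnj (v - of_real r * w) = w * (v * cnj v) - of_real r * v * (w * cnj w)"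
    by (simp add: algebra_simps)
  ultimately have "w - of_real r * v = w * v * cnj (v - of_real r * w)" by simp
  then show ?thesis using assms by (metis complex_mod_cnj mult_1 norm_mult)
qed

lemma poisson_swap:
  assumes "cmod w = 1" "cmod v = 1"
  shows "poisson (of_real r * w) v = poisson (of_real r * v) w"
  using assms cmod_circle_diff_swap[of w v r] by (simp add: poisson_def norm_mult)

text \<open>By symmetry the second kernel is, as a function of \<open>ecirc y\<close>, the boundary
  value of the real part of the holomorphic function \<open>H\<close>. The Poisson formula therefore
  reproduces \<open>Re H\<close> at \<open>of_real r * ecirc x\<close>, where it is the kernel of
  radius \<open>r * s\<close>.\<close>

lemma poisson_semigroup:
  assumes r: "0 \<le> r" "r < 1" and s: "0 \<le> s" "s < 1"
  shows "((\<lambda>y. poisson (of_real r * ecirc x) (ecirc y) * poisson (of_real s * ecirc z) (ecirc y))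
           has_integral poisson (of_real (r * s) * ecirc x) (ecirc z)) {0..1}"
proof -
  define H where "H = (\<lambda>w. (1 + of_real s * w * cnj (ecirc z)) / (1 - of_real s * w * cnj (ecirc z)))"
  \<comment> \<open>The Poisson formula asks for holomorphy beyond the closed disc; this
    \<open>R\<close> exceeds 1 while \<open>s * R < 1\<close> keeps the denominator of
    \<open>H\<close> away from zero.\<close>
  define R where "R = 2 / (1 + s)"
  have R: "1 < R" "s * R < 1" using s by (simp_all add: R_def divide_simps)
  have hol: "H holomorphic_on ball 0 R"
    unfolding H_def
  proof (intro holomorphic_intros)
    fix w :: complex assume "w \<in> ball 0 R"
    then have "s * cmod w \<le> s * R" using s by (intro mult_left_mono) auto
    then have "cmod (of_real s * w * cnj (ecirc z)) < 1" using R s by (simp add: norm_mult)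
    then show "1 - of_real s * w * cnj (ecirc z) \<noteq> 0" by auto
  qed
  have rs: "r * s < 1" using r s by (metis mult_less_cancel_left_disj mult_strict_mono' mult.left_neutral)
  have "((\<lambda>y. H (ecirc y) * complex_of_real (poisson (of_real r * ecirc x) (ecirc y))) has_integral
          H (of_real r * ecirc x)) {0..1}"
    using hol R(1) by (rule poisson_integral) (use r in \<open>simp add: norm_mult\<close>)
  from has_integral_Re[OF this]
  have "((\<lambda>y. poisson (of_real r * ecirc x) (ecirc y) * Re (H (ecirc y))) has_integral
          Re (H (of_real r * ecirc x))) {0..1}"
    by (simp add: mult.commute)
  moreover have "Re (H (ecirc y)) = poisson (of_real s * ecirc z) (ecirc y)" for y
    unfolding H_def using s by (subst Re_cayley_poisson) (auto simp: norm_mult intro: poisson_swap)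
  moreover have "Re (H (of_real r * ecirc x)) = poisson (of_real (r * s) * ecirc x) (ecirc z)"
    unfolding H_def using Re_cayley_poisson[of "of_real (r * s) * ecirc x" "ecirc z"] r s rs
    by (simp add: norm_mult mult_ac)
  ultimately show ?thesis by simp
qed

text \<open>Moving the pole from \<open>r * w\<close> to \<open>r * s * w\<close> shifts it by
  \<open>r * (1 - s)\<close>, at most \<open>1 - r * s\<close>, which is itself at most the distance
  \<open>?b\<close> from \<open>v\<close> to the new pole. So \<open>?a\<close> is at most
  \<open>2 * ?b\<close>, which costs a factor 4 in the squared denominators; the numerators cost a
  factor 2.\<close>

lemma poisson_mult_le:
  assumes "0 \<le> r" "r \<le> s" "s < 1" "cmod w = 1" "cmod v = 1"
  shows "poisson (of_real (r * s) * w) v \<le> 8 * poisson (of_real r * w) v"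
proof -
  let ?a = "cmod (v - of_real r * w)" and ?b = "cmod (v - of_real (r * s) * w)"
  have "?a \<le> ?b + cmod (of_real (r * (1 - s)) * w)"
    using norm_triangle_ineq4[of "v - of_real (r * s) * w" "of_real (r * (1 - s)) * w"]
    by (simp add: algebra_simps)
  also have "cmod (of_real (r * (1 - s)) * w) = r * (1 - s)"
    using assms by (simp add: norm_mult del: of_real_mult of_real_diff)
  also have "\<dots> \<le> 1 - r * s" using assms by (simp add: algebra_simps)
  also have "1 - r * s \<le> ?b"
    using norm_triangle_ineq2[of v "of_real (r * s) * w"] assms by (simp add: norm_mult)
  finally have ab: "?a \<le> 2 * ?b" by simp
  have "1 - r \<le> ?a"
    using norm_triangle_ineq2[of v "of_real r * w"] assms by (simp add: norm_mult)
  then have "0 < ?a" using assms by linarith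
  then have "0 < ?b" using ab by linarith
  have "r * r \<le> r * s" "r * s \<le> 1" using assms by (auto intro: mult_left_mono mult_le_one)
  then have "(r * r)\<^sup>2 \<le> (r * s)\<^sup>2" using assms by (intro power_mono) auto
  \<comment> \<open>Expanded, this says \<open>1 - r^4 \<le> 2 * (1 - r^2)\<close>, while
    \<open>r * r \<le> r * s\<close> gives \<open>1 - (r * s)^2 \<le> 1 - r^4\<close>.\<close>
  moreover have "(1 - r\<^sup>2) * (1 - r\<^sup>2) \<ge> 0" by simp
  ultimately have num: "1 - (r * s)\<^sup>2 \<le> 2 * (1 - r\<^sup>2)"
    by (simp add: algebra_simps power2_eq_square)
  have "r\<^sup>2 \<le> 1" using assms by (simp add: power_le_one)
  have "poisson (of_real (r * s) * w) v = (1 - (r * s)\<^sup>2) / ?b\<^sup>2"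
    using assms by (simp add: poisson_def norm_mult)
  also have "\<dots> \<le> 2 * (1 - r\<^sup>2) / (?a / 2)\<^sup>2"
    using ab \<open>0 < ?a\<close> \<open>r\<^sup>2 \<le> 1\<close> num by (intro frac_le power_mono) auto
  also have "\<dots> = 8 * poisson (of_real r * w) v"
    using assms by (simp add: poisson_def norm_mult power_divide)
  finally show ?thesis .
qed

text \<open>Up to the factor 8 the kernel with the smaller radius dominates. Adding both kernels
  covers either order of the radii and has the shape \<open>k x z + k z x\<close> that
  \<open>TTstar\<close> asks for.\<close>

lemma poisson_mult_le_add:
  assumes "0 \<le> r" "r < 1" "0 \<le> s" "s < 1" "cmod w = 1" "cmod v = 1"
  shows "poisson (of_real (r * s) * w) v \<le> 8 * (poisson (of_real r * w) v + poisson (of_real s * v) w)"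
proof (cases "r \<le> s")
  case True
  then show ?thesis
    using poisson_mult_le[of r s w v] poisson_nonneg[of "of_real s * v" w] assms by (simp add: norm_mult)
next
  case False
  then have "poisson (of_real (s * r) * v) w \<le> 8 * poisson (of_real s * v) w"
    using assms by (intro poisson_mult_le) auto
  then show ?thesis
    using poisson_nonneg[of "of_real r * w" v] poisson_swap[of w v "r * s"] assms
    by (simp add: norm_mult mult.commute[of s r])
qed

lemma poisson_le:
  assumes "0 \<le> r" "r < 1" "cmod w = 1" "cmod v = 1"
  shows "poisson (of_real r * w) v \<le> 2 / (1 - r)"
proof -
  have "1 - r \<le> cmod (v - of_real r * w)"
    using norm_triangle_ineq2[of v "of_real r * w"] assms by (simp add: norm_mult)
  then have "poisson (of_real r * w) v \<le> (1 - r\<^sup>2) / (1 - r)\<^sup>2"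
    using assms unfolding poisson_def
    by (intro frac_le power_mono) (auto simp: norm_mult power_le_one)
  also have "\<dots> = (1 + r) / (1 - r)"
    using assms by (simp add: power2_eq_square divide_simps) (simp add: algebra_simps)
  also have "\<dots> \<le> 2 / (1 - r)" using assms by (intro divide_right_mono) auto
  finally show ?thesis .
qed

lemma continuous_on_poisson:
  assumes "cmod z < 1" shows "continuous_on UNIV (\<lambda>t. poisson z (ecirc t))"
  unfolding poisson_def using assms by (intro continuous_intros) auto

lemma poisson_measurable [measurable (raw)]:
  assumes "f \<in> borel_measurable M" "g \<in> borel_measurable M"
  shows "(\<lambda>x. poisson (f x) (g x)) \<in> borel_measurable M"
  using assms unfolding poisson_def by measurable

section \<open>Parseval identity and radial maximal function\<close>

lemma integral_ecirc_power:
  "has_bochner_integral unif01 (\<lambda>t. ecirc t ^ m * cnj (ecirc t ^ n)) (if m = n then 1 else 0)"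
proof (rule has_bochner_integral_unif01)
  show "continuous_on UNIV (\<lambda>t. ecirc t ^ m * cnj (ecirc t ^ n))"
    by (intro continuous_intros)
  define k where "k = 2 * complex_of_real pi * \<i> * of_int (int m - int n)"
  have eq: "ecirc t ^ m * cnj (ecirc t ^ n) = exp (k * complex_of_real t)" for t
    by (simp add: ecirc_exp k_def exp_of_nat_mult[symmetric] exp_cnj exp_add[symmetric] algebra_simps)
  show "((\<lambda>t. ecirc t ^ m * cnj (ecirc t ^ n)) has_integral (if m = n then 1 else 0)) {0..1}"
  proof (cases "m = n")
    case True
    then have "ecirc t ^ m * cnj (ecirc t ^ n) = 1" for t by (subst eq) (simp add: k_def)
    then show ?thesis
      using True has_integral_const_real[of "1::complex" 0 1] by simp
  next
    case False
    then have "k \<noteq> 0" by (simp add: k_def)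
    have "((\<lambda>t. exp (k * complex_of_real t)) has_integral
            (exp (k * complex_of_real 1) / k - exp (k * complex_of_real 0) / k)) {0..1}"
      using \<open>k \<noteq> 0\<close> by (intro fundamental_theorem_of_calculus)
        (auto intro!: derivative_eq_intros has_vector_derivative_real_field)
    moreover have "exp k = 1" unfolding k_def
      by (auto simp: exp_eq_1 intro!: exI[of _ "int m - int n"])
    ultimately show ?thesis using False by (simp only: eq) simp
  qed
qed

lemma integral_norm2_trig_poly:
  fixes c :: "nat \<Rightarrow> complex"
  shows "has_bochner_integral unif01 (\<lambda>t. (cmod (\<Sum>n<N. c n * ecirc t ^ n))\<^sup>2) (\<Sum>n<N. (cmod (c n))\<^sup>2)"
proof -
  have "has_bochner_integral unif01
      (\<lambda>t. \<Sum>m<N. \<Sum>n<N. c m * cnj (c n) * (ecirc t ^ m * cnj (ecirc t ^ n)))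
      (\<Sum>m<N. \<Sum>n<N. c m * cnj (c n) * (if m = n then 1 else 0))"
    by (intro has_bochner_integral_sum has_bochner_integral_mult_right integral_ecirc_power)
  also have "(\<Sum>m<N. \<Sum>n<N. c m * cnj (c n) * (if m = n then 1 else 0)) = complex_of_real (\<Sum>n<N. (cmod (c n))\<^sup>2)"
    by (simp add: complex_norm_square[symmetric] if_distrib cong: if_cong)
  also have "(\<lambda>t. \<Sum>m<N. \<Sum>n<N. c m * cnj (c n) * (ecirc t ^ m * cnj (ecirc t ^ n)))
      = (\<lambda>t. complex_of_real ((cmod (\<Sum>n<N. c n * ecirc t ^ n))\<^sup>2))"
    by (simp only: complex_norm_square cnj_sum sum_product complex_cnj_mult mult_ac)
  finally have "has_bochner_integral unif01 (\<lambda>t. Re (complex_of_real ((cmod (\<Sum>n<N. c n * ecirc t ^ n))\<^sup>2)))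
       (Re (complex_of_real (\<Sum>n<N. (cmod (c n))\<^sup>2)))"
    by (rule has_bochner_integral_Re)
  then show ?thesis by simp
qed

text \<open>For trigonometric polynomials this is orthonormality of the powers of
  \<open>ecirc\<close>. The partial sums are bounded by \<open>K\<close>, the sum of the absolute
  values of the terms at radius \<open>r\<close>, so dominated convergence passes to the
  limit.\<close>

lemma parseval:
  assumes f: "\<And>z. cmod z < 1 \<Longrightarrow> (\<lambda>n. a n * z ^ n) sums f z"
    and r: "0 \<le> r" "r < 1"
  shows "(\<lambda>n. (cmod (a n))\<^sup>2 * r ^ (2 * n)) sums (LINT t|unif01. (cmod (f (of_real r * ecirc t)))\<^sup>2)"
    and "integrable unif01 (\<lambda>t. (cmod (f (of_real r * ecirc t)))\<^sup>2)"
proof -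
  define c where "c n = a n * of_real r ^ n" for n
  define s where "s N t = (\<Sum>n<N. c n * ecirc t ^ n)" for N t
  have c: "a n * (of_real r * ecirc t) ^ n = c n * ecirc t ^ n" "(cmod (c n))\<^sup>2 = (cmod (a n))\<^sup>2 * r ^ (2 * n)" for n t
    using r by (simp_all add: c_def power_mult_distrib norm_mult norm_power power_even_eq)
  have "summable (\<lambda>n. cmod (a n * (of_real r) ^ n))"
  proof (rule powser_insidea)
    \<comment> \<open>Convergence at a radius strictly between \<open>r\<close> and 1 yields
      absolute convergence at \<open>r\<close>.\<close>
    show "summable (\<lambda>n. a n * (of_real ((r + 1) / 2)) ^ n)"
      using r by (intro sums_summable[OF f]) (simp only: norm_of_real, simp)
    show "cmod (of_real r) < cmod (of_real ((r + 1) / 2))"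
      using r by (simp only: norm_of_real) simp
  qed
  then have sc: "summable (\<lambda>n. cmod (c n))" by (simp add: c_def)
  define K where "K = (\<Sum>n. cmod (c n))"
  have sK: "cmod (s N t) \<le> K" for N t
  proof -
    have "cmod (s N t) \<le> (\<Sum>n<N. cmod (c n))"
      unfolding s_def by (rule order_trans[OF norm_sum]) (simp add: norm_mult norm_power)
    also have "\<dots> \<le> K" unfolding K_def by (intro sum_le_suminf sc) auto
    finally show ?thesis .
  qed
  have lim: "(\<lambda>N. s N t) \<longlonglongrightarrow> f (of_real r * ecirc t)" for t
    using f[of "of_real r * ecirc t"] r unfolding sums_def s_def c by (simp add: norm_mult)
  have [measurable]: "s N \<in> borel_measurable borel" for N
    unfolding s_def by measurable
  have fm[measurable]: "(\<lambda>t. f (of_real r * ecirc t)) \<in> borel_measurable borel"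
    by (rule borel_measurable_LIMSEQ_metric[where f=s]) (simp, rule lim)
  have bd: "norm ((cmod (s N t))\<^sup>2) \<le> K\<^sup>2" for N t
    using power_mono[OF sK[of N t], of 2] by simp
  have lim2: "(\<lambda>N. (cmod (s N t))\<^sup>2) \<longlonglongrightarrow> (cmod (f (of_real r * ecirc t)))\<^sup>2" for t
    by (intro tendsto_intros lim)
  have dom: "integrable unif01 (\<lambda>t. (cmod (f (of_real r * ecirc t)))\<^sup>2)"
    "(\<lambda>N. LINT t|unif01. (cmod (s N t))\<^sup>2) \<longlonglongrightarrow> (LINT t|unif01. (cmod (f (of_real r * ecirc t)))\<^sup>2)"
  proof -
    show "integrable unif01 (\<lambda>t. (cmod (f (of_real r * ecirc t)))\<^sup>2)"
      by (rule integrable_dominated_convergence[where s="\<lambda>N t. (cmod (s N t))\<^sup>2" and w="\<lambda>_. K\<^sup>2"])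
        (auto simp only: bd lim2 intro!: AE_I2, measurable)
    show "(\<lambda>N. LINT t|unif01. (cmod (s N t))\<^sup>2) \<longlonglongrightarrow> (LINT t|unif01. (cmod (f (of_real r * ecirc t)))\<^sup>2)"
      by (rule integral_dominated_convergence[where w="\<lambda>_. K\<^sup>2"])
        (auto simp only: bd lim2 intro!: AE_I2, measurable)
  qed
  then show "integrable unif01 (\<lambda>t. (cmod (f (of_real r * ecirc t)))\<^sup>2)" by simp
  have "(LINT t|unif01. (cmod (s N t))\<^sup>2) = (\<Sum>n<N. (cmod (a n))\<^sup>2 * r ^ (2 * n))" for N
    using integral_norm2_trig_poly[of c N] unfolding has_bochner_integral_iff s_def c by simp
  then show "(\<lambda>n. (cmod (a n))\<^sup>2 * r ^ (2 * n)) sums (LINT t|unif01. (cmod (f (of_real r * ecirc t)))\<^sup>2)"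
    using dom(2) by (simp add: sums_def)
qed

lemma parseval_le:
  assumes f: "\<And>z. cmod z < 1 \<Longrightarrow> (\<lambda>n. a n * z ^ n) sums f z"
    and a: "summable (\<lambda>n. (cmod (a n))\<^sup>2)" and r: "0 \<le> r" "r < 1"
  shows "(\<integral>\<^sup>+t. ennreal ((cmod (f (of_real r * ecirc t)))\<^sup>2) \<partial>unif01) \<le> ennreal (\<Sum>n. (cmod (a n))\<^sup>2)"
proof -
  note P = parseval[OF f r]
  have "(LINT t|unif01. (cmod (f (of_real r * ecirc t)))\<^sup>2) \<le> (\<Sum>n. (cmod (a n))\<^sup>2)"
    using r by (intro sums_le[OF _ P(1) summable_sums[OF a]] mult_left_le power_le_one) auto
  then show ?thesis
    by (subst nn_integral_eq_integral[OF P(2)]) (auto intro: ennreal_leI)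
qed

section \<open>Maximal inequalities for Poisson integrals and for holomorphic functions\<close>

lemma nn_integral_poisson_mult_le:
  assumes r: "0 \<le> r" "r < 1" and s: "0 \<le> s" "s < 1"
  shows "(\<integral>\<^sup>+y. ennreal (poisson (of_real r * ecirc x) (ecirc y)) * ennreal (poisson (of_real s * ecirc z) (ecirc y)) \<partial>unif01)
    \<le> ennreal 8 * (ennreal (poisson (of_real r * ecirc x) (ecirc z)) + ennreal (poisson (of_real s * ecirc z) (ecirc x)))"
proof -
  have nonneg: "0 \<le> poisson (of_real r * ecirc x) w" "0 \<le> poisson (of_real s * ecirc z) w" for w
    using r s by (auto intro!: poisson_nonneg simp: norm_mult)
  have "has_bochner_integral unif01
     (\<lambda>y. poisson (of_real r * ecirc x) (ecirc y) * poisson (of_real s * ecirc z) (ecirc y))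
     (poisson (of_real (r * s) * ecirc x) (ecirc z))"
    using r s by (intro has_bochner_integral_unif01 poisson_semigroup continuous_on_mult continuous_on_poisson)
      (auto simp: norm_mult)
  then have "(\<integral>\<^sup>+y. ennreal (poisson (of_real r * ecirc x) (ecirc y) * poisson (of_real s * ecirc z) (ecirc y)) \<partial>unif01)
     = ennreal (poisson (of_real (r * s) * ecirc x) (ecirc z))"
    by (subst nn_integral_eq_integral) (auto simp: has_bochner_integral_iff nonneg)
  also have "\<dots> \<le> ennreal (8 * (poisson (of_real r * ecirc x) (ecirc z) + poisson (of_real s * ecirc z) (ecirc x)))"
    using r s by (intro ennreal_leI poisson_mult_le_add) auto
  finally show ?thesis
    using nonneg by (simp add: ennreal_mult ennreal_plus)
qed

text \<open>The constant is \<open>4 * 8^2\<close>, from \<open>TTstar\<close> with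
  \<open>C = 8\<close>. It depends neither on the radii nor on \<open>N\<close>, so the supremum can
  later be extended to countably many radii.\<close>

lemma poisson_maximal:
  fixes q :: "nat \<Rightarrow> real" and u :: "real \<Rightarrow> ennreal"
  assumes q: "\<And>i. 0 \<le> q i" "\<And>i. q i < 1" and [measurable]: "u \<in> borel_measurable borel"
  shows "(\<integral>\<^sup>+x. (SUP i\<in>{..N}. \<integral>\<^sup>+y. ennreal (poisson (of_real (q i) * ecirc x) (ecirc y)) * u y \<partial>unif01)\<^sup>2 \<partial>unif01)
    \<le> ennreal 256 * (\<integral>\<^sup>+x. (u x)\<^sup>2 \<partial>unif01)"
proof -
  define V where "V i x = (\<integral>\<^sup>+y. ennreal (poisson (of_real (q i) * ecirc x) (ecirc y)) * u y \<partial>unif01)" for i x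
  have [measurable]: "V i \<in> borel_measurable borel" for i
    unfolding V_def by measurable
  have "\<exists>i. i \<le> N \<and> V i x = (SUP i'\<in>{..N}. V i' x)" for x
  proof -
    have "(SUP i'\<in>{..N}. V i' x) \<in> (\<lambda>i'. V i' x) ` {..N}"
      by (simp add: Max_Sup[symmetric] Max_in)
    then show ?thesis by auto
  qed
  note ex = this
  \<comment> \<open>Taking the least maximizing index makes the selection measurable.\<close>
  define j where "j x = (LEAST i. i \<le> N \<and> V i x = (SUP i'\<in>{..N}. V i' x))" for x
  have j: "j x \<le> N" "V (j x) x = (SUP i'\<in>{..N}. V i' x)" for x
    using LeastI_ex[OF ex[of x]] by (auto simp: j_def)
  have [measurable]: "j \<in> measurable borel (count_space UNIV)"
    unfolding j_def by measurable
  \<comment> \<open>\<open>j x\<close> selects a radius attaining the supremum at \<open>x\<close>, which makes the maximal function linear in \<open>u\<close>\<close>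
  define k where "k x y = ennreal (poisson (of_real (q (j x)) * ecirc x) (ecirc y))" for x y
  have [measurable]: "(\<lambda>x. q (j x)) \<in> borel_measurable borel" by measurable
  have "(\<integral>\<^sup>+x. (\<integral>\<^sup>+y. k x y * u y \<partial>unif01)\<^sup>2 \<partial>unif01) \<le> ennreal (4 * 8\<^sup>2) * (\<integral>\<^sup>+x. (u x)\<^sup>2 \<partial>unif01)"
  proof (rule TTstar)
    show "(\<lambda>(x, y). k x y) \<in> borel_measurable (unif01 \<Otimes>\<^sub>M unif01)"
      unfolding k_def by measurable
    \<comment> \<open>Summing over all radii that can be selected makes the bound independent of
      \<open>j x\<close>.\<close>
    show "k x y \<le> ennreal (\<Sum>i\<le>N. 2 / (1 - q i))" for x y
      unfolding k_def
    proof (rule ennreal_leI)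
      have "poisson (of_real (q (j x)) * ecirc x) (ecirc y) \<le> 2 / (1 - q (j x))"
        using q by (intro poisson_le) auto
      also have "\<dots> \<le> (\<Sum>i\<le>N. 2 / (1 - q i))"
        using q j(1)[of x] by (intro member_le_sum) (auto simp: less_imp_le)
      finally show "poisson (of_real (q (j x)) * ecirc x) (ecirc y) \<le> (\<Sum>i\<le>N. 2 / (1 - q i))" .
    qed
    show "(\<integral>\<^sup>+y. k x y * k z y \<partial>unif01) \<le> ennreal 8 * (k x z + k z x)" for x z
      unfolding k_def using q by (intro nn_integral_poisson_mult_le) auto
  qed (auto intro: unif01.finite_measure_axioms)
  then show ?thesis
    using j(2) by (simp add: k_def V_def)
qed

text \<open>On finitely many circles \<open>h\<close> is dominated by Poisson integrals of its
  modulus on one larger circle of radius \<open>\<rho> < 1\<close>, to which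
  \<open>poisson_maximal\<close> applies. Monotone convergence extends this to all rational radii,
  and continuity of \<open>h\<close> to all radii.\<close>

lemma hardy_maximal:
  fixes h :: "complex \<Rightarrow> complex"
  assumes h: "h holomorphic_on ball 0 1"
    and S: "\<And>r. 0 \<le> r \<Longrightarrow> r < 1 \<Longrightarrow> (\<integral>\<^sup>+t. ennreal ((cmod (h (of_real r * ecirc t)))\<^sup>2) \<partial>unif01) \<le> S"
  obtains G where "G \<in> borel_measurable borel" "(\<integral>\<^sup>+t. G t \<partial>unif01) \<le> ennreal 256 * S"
    "\<And>r t. 0 \<le> r \<Longrightarrow> r < 1 \<Longrightarrow> ennreal ((cmod (h (of_real r * ecirc t)))\<^sup>2) \<le> G t"
proof -
  \<comment> \<open>A countable dense set of radii keeps the supremum \<open>G\<close>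
    measurable.\<close>
  define Q where "Q = {0..<1::real} \<inter> \<rat>"
  have Q: "countable Q" "0 \<in> Q" by (auto simp: Q_def countable_rat)
  define q where "q = from_nat_into Q"
  have q: "range q = Q" using Q by (auto simp: q_def intro!: range_from_nat_into)
  then have q01: "0 \<le> q i" "q i < 1" for i by (auto simp: Q_def set_eq_iff image_iff)
  have cont: "continuous_on UNIV (\<lambda>t. h (of_real r * ecirc t))" if "0 \<le> r" "r < 1" for r
    using that by (intro continuous_on_compose2[OF holomorphic_on_imp_continuous_on[OF h]] continuous_intros)
      (auto simp: norm_mult)
  have [measurable]: "(\<lambda>t. h (of_real (q i) * ecirc t)) \<in> borel_measurable borel" for i
    by (intro borel_measurable_continuous_onI cont q01)
  define G where "G t = (SUP N. SUP i\<in>{..N}. ennreal ((cmod (h (of_real (q i) * ecirc t)))\<^sup>2))" for t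
  have 1: "G \<in> borel_measurable borel" unfolding G_def by measurable
  have "(\<integral>\<^sup>+t. (SUP i\<in>{..N}. ennreal ((cmod (h (of_real (q i) * ecirc t)))\<^sup>2)) \<partial>unif01) \<le> ennreal 256 * S" for N
  proof -
    \<comment> \<open>The radius \<open>\<rho>\<close>, midway between the largest radius and 1,
      makes every quotient \<open>q i / \<rho>\<close> smaller than 1.\<close>
    define m where "m = (MAX i\<in>{..N}. q i)"
    have m: "q i \<le> m" if "i \<le> N" for i using that by (auto simp: m_def)
    have "m \<in> q ` {..N}" unfolding m_def by (intro Max_in) auto
    then have m01: "0 \<le> m" "m < 1" using q01 by auto
    define \<rho> where "\<rho> = (m + 1) / 2"
    have \<rho>: "0 < \<rho>" "\<rho> < 1" "m < \<rho>" using m01 by (auto simp: \<rho>_def)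
    \<comment> \<open>The value 0 beyond \<open>N\<close> keeps all radii below 1, as
      \<open>poisson_maximal\<close> requires; they do not enter its supremum.\<close>
    define p where "p i = (if i \<le> N then q i / \<rho> else 0)" for i
    have p: "0 \<le> p i" "p i < 1" for i
      using m[of i] \<rho> q01[of i] by (auto simp: p_def)
    define u where "u y = ennreal (cmod (h (of_real \<rho> * ecirc y)))" for y
    have [measurable]: "(\<lambda>t. h (of_real \<rho> * ecirc t)) \<in> borel_measurable borel"
      using \<rho> by (intro borel_measurable_continuous_onI cont) auto
    then have um: "u \<in> borel_measurable borel" unfolding u_def by measurable
    have hol: "(\<lambda>z. h (of_real \<rho> * z)) holomorphic_on ball 0 (1 / \<rho>)"
      using \<rho> by (intro holomorphic_on_compose_gen[OF _ h, unfolded o_def] holomorphic_intros)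
        (auto simp: norm_mult field_simps)
    have le: "ennreal (cmod (h (of_real (q i) * ecirc x)))
       \<le> (\<integral>\<^sup>+y. ennreal (poisson (of_real (p i) * ecirc x) (ecirc y)) * u y \<partial>unif01)" if "i \<le> N" for i x
    proof -
      have pn: "cmod (of_real (p i) * ecirc x) < 1" using p by (simp add: norm_mult)
      have "has_bochner_integral unif01 (\<lambda>t. h (of_real \<rho> * ecirc t) * complex_of_real (poisson (of_real (p i) * ecirc x) (ecirc t)))
             (h (of_real \<rho> * (of_real (p i) * ecirc x)))"
        using hol \<rho> pn by (intro has_bochner_integral_unif01 poisson_integral[where f="\<lambda>z. h (of_real \<rho> * z)"]
          continuous_intros cont continuous_on_of_real[OF continuous_on_poisson]) auto
      moreover have "of_real \<rho> * (of_real (p i) * ecirc x) = of_real (q i) * ecirc x"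
        using \<rho> that by (simp add: p_def)
      ultimately have B: "has_bochner_integral unif01 (\<lambda>t. h (of_real \<rho> * ecirc t) * complex_of_real (poisson (of_real (p i) * ecirc x) (ecirc t)))
             (h (of_real (q i) * ecirc x))" by simp
      have "ennreal (cmod (h (of_real (q i) * ecirc x)))
         \<le> (\<integral>\<^sup>+t. norm (h (of_real \<rho> * ecirc t) * complex_of_real (poisson (of_real (p i) * ecirc x) (ecirc t))) \<partial>unif01)"
        using B integral_norm_bound_ennreal[of unif01] unfolding has_bochner_integral_iff by force
      also have "\<dots> = (\<integral>\<^sup>+y. ennreal (poisson (of_real (p i) * ecirc x) (ecirc y)) * u y \<partial>unif01)"
        using poisson_nonneg[OF pn] by (intro nn_integral_cong) (simp add: norm_mult u_def ennreal_mult mult.commute)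
      finally show ?thesis .
    qed
    have "(\<integral>\<^sup>+t. (SUP i\<in>{..N}. ennreal ((cmod (h (of_real (q i) * ecirc t)))\<^sup>2)) \<partial>unif01)
      \<le> (\<integral>\<^sup>+x. (SUP i\<in>{..N}. \<integral>\<^sup>+y. ennreal (poisson (of_real (p i) * ecirc x) (ecirc y)) * u y \<partial>unif01)\<^sup>2 \<partial>unif01)"
    proof (intro nn_integral_mono SUP_least)
      fix x i assume "i \<in> {..N}"
      then have "ennreal (cmod (h (of_real (q i) * ecirc x))) \<le> (SUP i\<in>{..N}. \<integral>\<^sup>+y. ennreal (poisson (of_real (p i) * ecirc x) (ecirc y)) * u y \<partial>unif01)"
        by (intro SUP_upper2[of i]) (auto intro: le)
      from power_mono_ennreal[OF this, of 2]
      show "ennreal ((cmod (h (of_real (q i) * ecirc x)))\<^sup>2) \<le> (SUP i\<in>{..N}. \<integral>\<^sup>+y. ennreal (poisson (of_real (p i) * ecirc x) (ecirc y)) * u y \<partial>unif01)\<^sup>2"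
        by (simp add: ennreal_power)
    qed
    also have "\<dots> \<le> ennreal 256 * (\<integral>\<^sup>+x. (u x)\<^sup>2 \<partial>unif01)"
      using p um by (rule poisson_maximal)
    also have "\<dots> \<le> ennreal 256 * S"
      using S[of \<rho>] \<rho> by (intro mult_left_mono) (auto simp: u_def ennreal_power)
    finally show ?thesis .
  qed
  moreover have "(\<integral>\<^sup>+t. G t \<partial>unif01) = (SUP N. \<integral>\<^sup>+t. (SUP i\<in>{..N}. ennreal ((cmod (h (of_real (q i) * ecirc t)))\<^sup>2)) \<partial>unif01)"
    unfolding G_def
    by (rule nn_integral_monotone_convergence_SUP)
       (auto simp: incseq_def le_fun_def intro!: SUP_subset_mono)
  ultimately have 2: "(\<integral>\<^sup>+t. G t \<partial>unif01) \<le> ennreal 256 * S" by (auto intro: SUP_least)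
  have 3: "ennreal ((cmod (h (of_real r * ecirc t)))\<^sup>2) \<le> G t" if r: "0 \<le> r" "r < 1" for r t
  proof -
    have Gq: "ennreal ((cmod (h (of_real s * ecirc t)))\<^sup>2) \<le> G t" if "s \<in> Q" for s
    proof -
      obtain i where "s = q i" using \<open>s \<in> Q\<close> by (auto simp: q[symmetric])
      then show ?thesis unfolding G_def by (intro SUP_upper2[of i]) (auto intro: SUP_upper)
    qed
    have "r \<in> closure Q"
    proof -
      have "\<exists>y\<in>Q. dist y r < e" if "0 < e" for e
      proof -
        obtain y where "y \<in> \<rat>" "r < y" "y < min 1 (r + e)"
          using Rats_dense_in_real[of r "min 1 (r + e)"] r \<open>0 < e\<close> by auto
        then show ?thesis using r by (intro bexI[of _ y]) (auto simp: Q_def dist_real_def)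
      qed
      then show ?thesis by (auto simp: closure_approachable)
    qed
    then obtain s where s: "\<And>n. s n \<in> Q" "s \<longlonglongrightarrow> r" by (auto simp: closure_sequential)
    have "isCont h (of_real r * ecirc t)"
      using h r by (auto intro!: continuous_on_interior[OF holomorphic_on_imp_continuous_on] simp: norm_mult)
    then have "(\<lambda>n. h (of_real (s n) * ecirc t)) \<longlonglongrightarrow> h (of_real r * ecirc t)"
      by (rule isCont_tendsto_compose) (intro tendsto_intros s)
    then have "(\<lambda>n. ennreal ((cmod (h (of_real (s n) * ecirc t)))\<^sup>2)) \<longlonglongrightarrow> ennreal ((cmod (h (of_real r * ecirc t)))\<^sup>2)"
      by (intro tendsto_intros tendsto_ennrealI)
    then show ?thesis
      by (rule LIMSEQ_le_const2) (use s Gq in auto)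
  qed
  show ?thesis using that 1 2 3 by blast
qed

section \<open>Radial limits in the Hardy space of the disc\<close>

text \<open>A fixed sequence of radii tending to 1, for limit theorems on sequences. The double
  successor makes even the first radius positive.\<close>

definition rad :: "nat \<Rightarrow> real" where
  "rad k = 1 - inverse (real (Suc (Suc k)))"

lemma rad_bounds: "0 < rad k" "rad k < 1"
  by (simp_all add: rad_def field_simps)

lemma rad_tendsto: "rad \<longlonglongrightarrow> 1"
proof -
  have "(\<lambda>k. 1 - inverse (real (Suc (Suc k)))) \<longlonglongrightarrow> 1 - 0"
    by (intro tendsto_diff tendsto_const LIMSEQ_Suc[OF LIMSEQ_inverse_real_of_nat])
  then show ?thesis by (simp add: rad_def[abs_def])
qed

lemma filterlim_rad: "filterlim rad (at_left 1) sequentially"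
  unfolding filterlim_at using rad_tendsto by (auto intro!: always_eventually simp: rad_bounds less_imp_neq)

text \<open>The values along \<open>rad\<close> form a Cauchy sequence; the same Cauchy condition
  makes its limit the limit along all radii.\<close>

lemma at_left_Cauchy_limit:
  fixes g :: "real \<Rightarrow> 'a::complete_space"
  assumes "\<And>e. 0 < e \<Longrightarrow> \<exists>d<1. \<forall>r s. d < r \<and> r < 1 \<longrightarrow> d < s \<and> s < 1 \<longrightarrow> dist (g r) (g s) < e"
  shows "\<exists>l. (g \<longlongrightarrow> l) (at_left 1)"
proof -
  have ev: "eventually (\<lambda>k. d < rad k) sequentially" if "d < 1" for d
    using rad_tendsto that by (rule order_tendstoD)
  have "Cauchy (\<lambda>k. g (rad k))"
  proof (rule metric_CauchyI)
    fix e :: real assume "0 < e"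
    then obtain d where "d < 1" and d: "\<And>r s. d < r \<Longrightarrow> r < 1 \<Longrightarrow> d < s \<Longrightarrow> s < 1 \<Longrightarrow> dist (g r) (g s) < e"
      using assms by blast
    then obtain M where "\<And>k. M \<le> k \<Longrightarrow> d < rad k" using ev[of d] by (auto simp: eventually_sequentially)
    then show "\<exists>M. \<forall>m\<ge>M. \<forall>n\<ge>M. dist (g (rad m)) (g (rad n)) < e"
      using d rad_bounds by blast
  qed
  then obtain l where l: "(\<lambda>k. g (rad k)) \<longlonglongrightarrow> l" by (auto simp: Cauchy_convergent_iff convergent_def)
  have "(g \<longlongrightarrow> l) (at_left 1)"
  proof (rule tendstoI)
    fix e :: real assume "0 < e"
    then obtain d where "d < 1" and d: "\<And>r s. d < r \<Longrightarrow> r < 1 \<Longrightarrow> d < s \<Longrightarrow> s < 1 \<Longrightarrow> dist (g r) (g s) < e/2"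
      using assms[of "e/2"] by auto
    have "eventually (\<lambda>k. d < rad k \<and> dist (g (rad k)) l < e/2) sequentially"
      using ev[OF \<open>d < 1\<close>] tendstoD[OF l, of "e/2"] \<open>0 < e\<close> by (simp add: eventually_conj)
    then obtain k where k: "d < rad k" "dist (g (rad k)) l < e/2"
      by (auto simp: eventually_sequentially)
    show "eventually (\<lambda>r. dist (g r) l < e) (at_left 1)"
      unfolding eventually_at_left_field
    proof (intro exI[of _ d] conjI allI impI)
      fix r assume "d < r" "r < 1"
      then have "dist (g r) (g (rad k)) < e/2" using d k rad_bounds by blast
      then show "dist (g r) l < e" using k(2) dist_triangle[of "g r" l "g (rad k)"] by linarith
    qed (fact \<open>d < 1\<close>)
  qed
  then show ?thesis ..
qed

context
  fixes f :: "complex \<Rightarrow> complex" and a :: "nat \<Rightarrow> complex"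
  assumes f: "\<And>z. cmod z < 1 \<Longrightarrow> (\<lambda>n. a n * z ^ n) sums f z"
    and a: "summable (\<lambda>n. (cmod (a n))\<^sup>2)"
begin

text \<open>The remainder after \<open>N\<close> terms is a power series with the first
  \<open>N\<close> coefficients set to zero. Parseval bounds its means by the tail of the
  coefficient sum, so the majorants have integrals tending to 0 as \<open>N\<close> grows.\<close>

lemma power_series_tail_maximal:
  "\<exists>G. G \<in> borel_measurable borel \<and>
    (\<integral>\<^sup>+t. G t \<partial>unif01) \<le> ennreal 256 * ennreal (\<Sum>n. (cmod (a (n + N)))\<^sup>2) \<and>
    (\<forall>r t. 0 \<le> r \<longrightarrow> r < 1 \<longrightarrow>
       ennreal ((cmod (f (of_real r * ecirc t) - (\<Sum>n<N. a n * (of_real r * ecirc t) ^ n)))\<^sup>2) \<le> G t)"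
proof -
  define h where "h z = f z - (\<Sum>n<N. a n * z ^ n)" for z
  define b where "b n = (if n < N then 0 else a n)" for n
  have h: "(\<lambda>n. b n * z ^ n) sums h z" if "cmod z < 1" for z
  proof -
    have "(\<lambda>n. a n * z ^ n - (if n \<in> {..<N} then a n * z ^ n else 0)) sums h z"
      unfolding h_def by (intro sums_diff f that sums_If_finite_set) auto
    then show ?thesis by (rule sums_cong[THEN iffD1, rotated]) (auto simp: b_def)
  qed
  have b: "(\<lambda>n. (cmod (b n))\<^sup>2) sums (\<Sum>n. (cmod (a (n + N)))\<^sup>2)"
  proof -
    have "(\<lambda>n. (cmod (b (n + N)))\<^sup>2) sums (\<Sum>n. (cmod (a (n + N)))\<^sup>2)"
      using a by (auto simp: b_def intro!: summable_sums summable_ignore_initial_segment)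
    then show ?thesis
      by (subst (asm) sums_iff_shift) (simp add: b_def)
  qed
  have "h holomorphic_on ball 0 1"
    using h by (intro power_series_holomorphic[where a=b]) simp
  then show ?thesis
  proof (rule hardy_maximal[of h "ennreal (\<Sum>n. (cmod (a (n + N)))\<^sup>2)"])
    show "(\<integral>\<^sup>+t. ennreal ((cmod (h (of_real r * ecirc t)))\<^sup>2) \<partial>unif01) \<le> ennreal (\<Sum>n. (cmod (a (n + N)))\<^sup>2)"
      if "0 \<le> r" "r < 1" for r
      using parseval_le[OF h sums_summable[OF b] that] sums_unique[OF b] by simp
  qed (unfold h_def, blast)
qed

text \<open>The polynomial part converges along every radius, so the oscillation of \<open>f\<close>
  near the boundary is controlled by the tail majorants \<open>G N\<close>. Their infimum has
  integral zero and hence vanishes almost everywhere, which gives the Cauchy condition.\<close>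

theorem hardy_radial_limit:
  "AE t in unif01. \<exists>l. ((\<lambda>r. f (of_real r * ecirc t)) \<longlongrightarrow> l) (at_left 1)"
proof -
  define p where "p N z = (\<Sum>n<N. a n * z ^ n)" for N z
  have "\<exists>G. \<forall>N. G N \<in> borel_measurable borel \<and> (\<integral>\<^sup>+t. G N t \<partial>unif01) \<le> ennreal 256 * ennreal (\<Sum>n. (cmod (a (n + N)))\<^sup>2)
     \<and> (\<forall>r t. 0 \<le> r \<longrightarrow> r < 1 \<longrightarrow> ennreal ((cmod (f (of_real r * ecirc t) - p N (of_real r * ecirc t)))\<^sup>2) \<le> G N t)"
    unfolding p_def by (intro choice allI power_series_tail_maximal)
  then obtain G where G[measurable]: "\<And>N. G N \<in> borel_measurable borel"
    and GS: "\<And>N. (\<integral>\<^sup>+t. G N t \<partial>unif01) \<le> ennreal 256 * ennreal (\<Sum>n. (cmod (a (n + N)))\<^sup>2)"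
    and Gf: "\<And>N r t. 0 \<le> r \<Longrightarrow> r < 1 \<Longrightarrow> ennreal ((cmod (f (of_real r * ecirc t) - p N (of_real r * ecirc t)))\<^sup>2) \<le> G N t"
    by blast
  have "(\<lambda>N. ennreal 256 * ennreal (\<Sum>n. (cmod (a (n + N)))\<^sup>2)) \<longlonglongrightarrow> ennreal 256 * ennreal 0"
    by (intro ennreal_tendsto_cmult tendsto_ennrealI suminf_exist_split2 a) auto
  moreover have "(\<integral>\<^sup>+t. (INF N. G N t) \<partial>unif01) \<le> ennreal 256 * ennreal (\<Sum>n. (cmod (a (n + N)))\<^sup>2)" for N
    by (rule order_trans[OF nn_integral_mono GS]) (auto intro: INF_lower)
  ultimately have "(\<integral>\<^sup>+t. (INF N. G N t) \<partial>unif01) \<le> 0"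
    by (intro LIMSEQ_le_const[where X="\<lambda>N. ennreal 256 * ennreal (\<Sum>n. (cmod (a (n + N)))\<^sup>2)"]) auto
  then have "AE t in unif01. (INF N. G N t) = 0"
    by (subst nn_integral_0_iff_AE[symmetric]) auto
  then show ?thesis
  proof eventually_elim
    fix t assume INF: "(INF N. G N t) = 0"
    show "\<exists>l. ((\<lambda>r. f (of_real r * ecirc t)) \<longlongrightarrow> l) (at_left 1)"
    proof (rule at_left_Cauchy_limit)
      fix e :: real assume "0 < e"
      then have "(INF N. G N t) < ennreal ((e/4)\<^sup>2)" by (simp add: INF)
      then obtain N where N: "G N t < ennreal ((e/4)\<^sup>2)" by (auto simp: INF_less_iff)
      have fp: "dist (f (of_real r * ecirc t)) (p N (of_real r * ecirc t)) < e/4" if "0 \<le> r" "r < 1" for r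
      proof -
        have "ennreal ((cmod (f (of_real r * ecirc t) - p N (of_real r * ecirc t)))\<^sup>2) < ennreal ((e/4)\<^sup>2)"
          using Gf[OF that] N by (rule le_less_trans)
        then have "(cmod (f (of_real r * ecirc t) - p N (of_real r * ecirc t)))\<^sup>2 < (e/4)\<^sup>2"
          by (simp add: ennreal_less_iff)
        then show ?thesis using \<open>0 < e\<close> by (auto simp: dist_norm dest: power_less_imp_less_base)
      qed
      have "((\<lambda>r. p N (of_real r * ecirc t)) \<longlongrightarrow> p N (of_real 1 * ecirc t)) (at_left 1)"
        unfolding p_def by (intro tendsto_intros)
      then have "eventually (\<lambda>r. dist (p N (of_real r * ecirc t)) (p N (of_real 1 * ecirc t)) < e/4) (at_left 1)"
        by (rule tendstoD) (use \<open>0 < e\<close> in simp)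
      then obtain d where "d < 1" and d: "\<And>r. d < r \<Longrightarrow> r < 1 \<Longrightarrow> dist (p N (of_real r * ecirc t)) (p N (of_real 1 * ecirc t)) < e/4"
        unfolding eventually_at_left_field by auto
      show "\<exists>d<1. \<forall>r s. d < r \<and> r < 1 \<longrightarrow> d < s \<and> s < 1 \<longrightarrow>
              dist (f (of_real r * ecirc t)) (f (of_real s * ecirc t)) < e"
      proof (intro exI[of _ "max 0 d"] conjI allI impI)
        fix r s assume rs: "max 0 d < r \<and> r < 1" "max 0 d < s \<and> s < 1"
        let ?P = "p N (of_real 1 * ecirc t)"
        have "dist (f (of_real r * ecirc t)) ?P < e/2" "dist (f (of_real s * ecirc t)) ?P < e/2"
          using fp[of r] d[of r] fp[of s] d[of s] rs
            dist_triangle[of "f (of_real r * ecirc t)" ?P "p N (of_real r * ecirc t)"]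
            dist_triangle[of "f (of_real s * ecirc t)" ?P "p N (of_real s * ecirc t)"] by auto
        then show "dist (f (of_real r * ecirc t)) (f (of_real s * ecirc t)) < e"
          by (rule dist_triangle_half_l)
      qed (use \<open>d < 1\<close> in auto)
    qed
  qed
qed

text \<open>By Parseval the means increase with the radius. Along \<open>rad\<close> they converge
  to the boundary integral by dominated convergence; the majorant is that of the tail with
  \<open>N = 0\<close>, which is \<open>f\<close> itself.\<close>

theorem hardy_norm_le_boundary:
  assumes [measurable]: "g \<in> borel_measurable borel"
    and g: "AE t in unif01. ((\<lambda>r. f (of_real r * ecirc t)) \<longlongrightarrow> g t) (at_left 1)"
    and r: "0 \<le> r" "r < 1"
  shows "(\<integral>\<^sup>+t. ennreal ((cmod (f (of_real r * ecirc t)))\<^sup>2) \<partial>unif01) \<le> (\<integral>\<^sup>+t. ennreal ((cmod (g t))\<^sup>2) \<partial>unif01)"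
proof -
  let ?\<Phi> = "\<lambda>r. \<integral>\<^sup>+t. ennreal ((cmod (f (of_real r * ecirc t)))\<^sup>2) \<partial>unif01"
  obtain G where [measurable]: "G \<in> borel_measurable borel"
    and GS: "(\<integral>\<^sup>+t. G t \<partial>unif01) \<le> ennreal 256 * ennreal (\<Sum>n. (cmod (a (n + 0)))\<^sup>2)"
    and Gf: "\<And>r t. 0 \<le> r \<Longrightarrow> r < 1 \<Longrightarrow> ennreal ((cmod (f (of_real r * ecirc t) - (\<Sum>n<0. a n * (of_real r * ecirc t) ^ n)))\<^sup>2) \<le> G t"
    using power_series_tail_maximal[of 0] by blast
  have \<Phi>: "?\<Phi> s = ennreal (\<Sum>n. (cmod (a n))\<^sup>2 * s ^ (2 * n))" if "0 \<le> s" "s < 1" for s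
    using nn_integral_eq_integral[OF parseval(2)[OF f that]] sums_unique[OF parseval(1)[OF f that]] by simp
  have "?\<Phi> r \<le> ?\<Phi> s" if "r \<le> s" "s < 1" for s
  proof -
    have "0 \<le> s" using r that by simp
    then show ?thesis
      unfolding \<Phi>[OF r] \<Phi>[OF \<open>0 \<le> s\<close> \<open>s < 1\<close>]
      using r that sums_summable[OF parseval(1)[OF f r]] sums_summable[OF parseval(1)[OF f \<open>0 \<le> s\<close> \<open>s < 1\<close>]]
      by (intro ennreal_leI suminf_le mult_left_mono power_mono) simp_all
  qed
  moreover have "eventually (\<lambda>k. r < rad k) sequentially"
    using rad_tendsto r(2) by (rule order_tendstoD)
  ultimately have "eventually (\<lambda>k. ?\<Phi> r \<le> ?\<Phi> (rad k)) sequentially"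
    by (auto elim!: eventually_mono simp: rad_bounds)
  moreover have "(\<lambda>k. ?\<Phi> (rad k)) \<longlonglongrightarrow> (\<integral>\<^sup>+t. ennreal ((cmod (g t))\<^sup>2) \<partial>unif01)"
  proof (rule nn_integral_dominated_convergence[where w=G])
    have "(\<lambda>t. f (of_real (rad k) * ecirc t)) \<in> borel_measurable borel" for k
    proof -
      have "f holomorphic_on ball 0 1"
        using f by (intro power_series_holomorphic[where a=a]) simp
      then have "continuous_on UNIV (\<lambda>t. f (of_real (rad k) * ecirc t))"
        using rad_bounds[of k]
        by (intro continuous_on_compose2[OF holomorphic_on_imp_continuous_on, of f "ball 0 1" UNIV] continuous_intros)
          (auto simp: norm_mult)
      then show ?thesis by (rule borel_measurable_continuous_onI)
    qed
    note [measurable] = this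
    show "(\<lambda>t. ennreal ((cmod (f (of_real (rad k) * ecirc t)))\<^sup>2)) \<in> borel_measurable unif01" for k
      by measurable
    show "AE t in unif01. ennreal ((cmod (f (of_real (rad k) * ecirc t)))\<^sup>2) \<le> G t" for k
      using Gf[of "rad k"] rad_bounds[of k] by (auto simp: less_imp_le)
    show "(\<integral>\<^sup>+t. G t \<partial>unif01) < \<infinity>"
      by (rule le_less_trans[OF GS]) (simp add: ennreal_mult_less_top)
    show "AE t in unif01. (\<lambda>k. ennreal ((cmod (f (of_real (rad k) * ecirc t)))\<^sup>2)) \<longlonglongrightarrow> ennreal ((cmod (g t))\<^sup>2)"
      using g
    proof eventually_elim
      case (elim t)
      from filterlim_compose[OF elim filterlim_rad]
      show ?case by (intro tendsto_ennrealI tendsto_intros)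
    qed
  qed auto
  ultimately show ?thesis
    by (intro tendsto_lowerbound[where f="\<lambda>k. ?\<Phi> (rad k)"]) auto
qed

end

section \<open>Surface measure on the distinguished boundary\<close>

text \<open>The surface measure before completion, with the Borel sets as its sets: Tonelli and
  measurability arguments are carried out here and transferred to \<open>Sigma_bd\<close>
  afterwards.\<close>

definition bd_measure :: "('n::finite \<Rightarrow> 'k) \<Rightarrow> (complex^'n) measure" where
  "bd_measure blk = distr (uniform_measure lborel (prod_ball blk)) borel (radproj blk)"

lemma Sigma_bd_eq: "Sigma_bd blk = completion (bd_measure blk)"
  by (simp add: Sigma_bd_def bd_measure_def)

lemma sets_bd_measure [simp, measurable_cong]: "sets (bd_measure blk) = sets borel"
  and space_bd_measure [simp]: "space (bd_measure blk) = UNIV"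
  by (simp_all add: bd_measure_def)

section \<open>Block norms and the product of balls\<close>

lemma scaleR_eq_vec_scale: "r *\<^sub>R (z::complex^'n) = complex_of_real r *s z"
  by (simp add: vec_eq_iff scaleR_conv_of_real[where 'a=complex])

lemma blk_norm2_nonneg [simp]: "0 \<le> blk_norm2 blk b z"
  by (simp add: blk_norm2_def sum_nonneg)

lemma blk_norm2_scale: "blk_norm2 blk b (c *s z) = (cmod c)\<^sup>2 * blk_norm2 blk b z"
  by (simp add: blk_norm2_def norm_mult power_mult_distrib sum_distrib_left)

lemma continuous_on_blk_norm2 [continuous_intros]:
  "continuous_on A f \<Longrightarrow> continuous_on A (\<lambda>x. blk_norm2 blk b (f x))"
  unfolding blk_norm2_def by (intro continuous_intros)

lemma blk_norm2_measurable [measurable]: "blk_norm2 blk b \<in> borel_measurable borel"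
  by (intro borel_measurable_continuous_onI continuous_intros)

lemma vec_nth_measurable [measurable]: "(\<lambda>z::complex^'n. z $ i) \<in> borel_measurable borel"
  by (intro borel_measurable_continuous_onI continuous_intros)

lemma open_prod_ball: "open (prod_ball (blk :: 'n::finite \<Rightarrow> 'k::finite))"
proof -
  have "prod_ball blk = (\<Inter>b. {z. blk_norm2 blk b z < 1})"
    by (auto simp: prod_ball_def)
  also have "open \<dots>"
    by (intro open_INT finite open_Collect_less continuous_intros ballI)
  finally show ?thesis .
qed

lemma prod_ball_measurable [measurable]: "prod_ball (blk :: 'n::finite \<Rightarrow> 'k::finite) \<in> sets borel"
  by (intro borel_open open_prod_ball)

lemma dist_bdry_measurable [measurable]: "dist_bdry (blk :: 'n::finite \<Rightarrow> 'k::finite) \<in> sets borel"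
  unfolding dist_bdry_def by measurable

lemma bounded_prod_ball: "bounded (prod_ball (blk :: 'n::finite \<Rightarrow> 'k::finite))"
proof (rule boundedI)
  fix z assume z: "z \<in> prod_ball blk"
  have "norm (z $ i) \<le> 1" for i
  proof -
    have "(cmod (z $ i))\<^sup>2 \<le> blk_norm2 blk (blk i) z"
      unfolding blk_norm2_def by (intro member_le_sum) auto
    also have "\<dots> \<le> 1\<^sup>2" using z by (auto simp: prod_ball_def less_imp_le)
    finally show ?thesis by (rule power2_le_imp_le) simp
  qed
  then have "(\<Sum>i\<in>UNIV. norm (z $ i)) \<le> (\<Sum>i\<in>(UNIV::'n set). 1)" by (intro sum_mono)
  moreover have "norm z \<le> (\<Sum>i\<in>UNIV. norm (z $ i))"
    unfolding norm_vec_def by (intro L2_set_le_sum) auto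
  ultimately show "norm z \<le> real CARD('n)" by simp
qed

lemma emeasure_prod_ball:
  fixes blk :: "'n::finite \<Rightarrow> 'k::finite"
  shows "0 < emeasure lborel (prod_ball blk)" "emeasure lborel (prod_ball blk) < \<infinity>"
proof -
  show "emeasure lborel (prod_ball blk) < \<infinity>"
    by (intro emeasure_bounded_finite bounded_prod_ball)
  have "0 \<in> prod_ball blk" by (simp add: prod_ball_def blk_norm2_def)
  then have "prod_ball blk \<notin> null_sets lborel"
    using open_not_negligible[OF open_prod_ball, of blk] by (auto simp: negligible_iff_null_sets null_sets_completion_iff)
  then show "0 < emeasure lborel (prod_ball blk)"
    by (auto simp: null_sets_def zero_less_iff_neq_zero)
qed

lemma radproj_measurable [measurable]:
  "radproj (blk :: 'n::finite \<Rightarrow> 'k::finite) \<in> borel_measurable borel"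
proof (subst borel_measurable_euclidean_space, intro ballI)
  fix i :: "complex^'n" assume "i \<in> Basis"
  then obtain j u where i: "i = axis j u" by (auto simp: Basis_vec_def)
  show "(\<lambda>z. radproj blk z \<bullet> i) \<in> borel_measurable borel"
    unfolding i inner_axis radproj_def by simp
qed

lemma nn_integral_bd_measure:
  fixes blk :: "'n::finite \<Rightarrow> 'k::finite"
  assumes [measurable]: "g \<in> borel_measurable borel"
  shows "(\<integral>\<^sup>+\<zeta>. g \<zeta> \<partial>bd_measure blk)
    = (\<integral>\<^sup>+z. g (radproj blk z) * indicator (prod_ball blk) z \<partial>lborel) / emeasure lborel (prod_ball blk)"
  unfolding bd_measure_def by (simp add: nn_integral_distr nn_integral_uniform_measure)

lemma prob_bd_measure: "emeasure (bd_measure (blk :: 'n::finite \<Rightarrow> 'k::finite)) UNIV = 1"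
  using nn_integral_bd_measure[of "\<lambda>_. 1" blk] emeasure_prod_ball[of blk]
  by (simp add: ennreal_divide_self)

lemma finite_measure_bd_measure: "finite_measure (bd_measure (blk :: 'n::finite \<Rightarrow> 'k::finite))"
  by standard (simp add: prob_bd_measure)

text \<open>\<open>radproj\<close> divides by zero where a block vanishes. Off the coordinate
  hyperplanes, which are null sets, every block norm is positive, as surjectivity of
  \<open>blk\<close> gives each block a coordinate; there \<open>radproj\<close> normalizes every
  block to 1.\<close>

lemma AE_bd_measure_dist_bdry:
  fixes blk :: "'n::finite \<Rightarrow> 'k::finite"
  assumes "surj blk"
  shows "AE \<zeta> in bd_measure blk. \<zeta> \<in> dist_bdry blk"
proof -
  have "AE z in lborel. z $ j \<noteq> (0::complex)" for j :: 'n
  proof -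
    have "{z::complex^'n. z \<bullet> axis j 1 = 0} \<in> null_sets lborel"
      using negligible_standard_hyperplane[of "axis j 1 :: complex^'n" 0]
      by (subst null_sets_completion_iff[symmetric])
         (auto simp: negligible_iff_null_sets axis_in_Basis_iff Basis_complex_def)
    then have "AE z in lborel. z \<notin> {z::complex^'n. z \<bullet> axis j 1 = 0}" by (rule AE_not_in)
    then show ?thesis by eventually_elim (auto simp: inner_axis)
  qed
  then have "AE z in lborel. \<forall>j. (z::complex^'n) $ j \<noteq> 0" by (simp add: AE_all_countable)
  then have "AE z in lborel. radproj blk z \<in> dist_bdry blk"
  proof eventually_elim
    fix z :: "complex^'n" assume z: "\<forall>j. z $ j \<noteq> 0"
    have pos: "0 < blk_norm2 blk b z" for b
    proof -
      obtain j where "blk j = b" using assms by (metis surjD)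
      then have "0 < (cmod (z $ j))\<^sup>2" "(cmod (z $ j))\<^sup>2 \<le> blk_norm2 blk b z"
        using z unfolding blk_norm2_def by (auto intro!: member_le_sum)
      then show ?thesis by linarith
    qed
    have "blk_norm2 blk b (radproj blk z) = 1" for b
    proof -
      have "blk_norm2 blk b (radproj blk z) = (\<Sum>j\<in>{j. blk j = b}. (cmod (z $ j))\<^sup>2 / blk_norm2 blk b z)"
        unfolding blk_norm2_def[of blk b "radproj blk z"]
        by (intro sum.cong) (auto simp: radproj_def norm_divide power_divide)
      also have "\<dots> = blk_norm2 blk b z / blk_norm2 blk b z"
        by (simp add: blk_norm2_def sum_divide_distrib[symmetric])
      finally show ?thesis using pos[of b] by simp
    qed
    then show "radproj blk z \<in> dist_bdry blk" by (simp add: dist_bdry_def)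
  qed
  then show ?thesis
    unfolding bd_measure_def by (subst AE_distr_iff) (auto intro!: AE_uniform_measureI)
qed

lemma vec_scale_measurable [measurable (raw)]:
  fixes g :: "'a \<Rightarrow> complex^'n"
  assumes "c \<in> borel_measurable M" "g \<in> borel_measurable M"
  shows "(\<lambda>x. c x *s g x) \<in> borel_measurable M"
proof -
  have "(\<lambda>p. fst p *s snd p :: complex^'n) \<in> borel_measurable borel"
    unfolding vector_scalar_mult_def by (intro borel_measurable_continuous_onI continuous_intros)
  from measurable_compose[OF _ this, of "\<lambda>x. (c x, g x)" M] assms show ?thesis by simp
qed

text \<open>Multiplication by \<open>c\<close> is a surjective linear isometry, so it preserves
  Lebesgue measure; it also preserves the product of balls and commutes with
  \<open>radproj\<close>.\<close>

lemma nn_integral_bd_measure_rotate: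
  fixes blk :: "'n::finite \<Rightarrow> 'k::finite"
  assumes c: "cmod c = 1" and [measurable]: "g \<in> borel_measurable borel"
  shows "(\<integral>\<^sup>+\<zeta>. g (c *s \<zeta>) \<partial>bd_measure blk) = (\<integral>\<^sup>+\<zeta>. g \<zeta> \<partial>bd_measure blk)"
proof -
  let ?L = "\<lambda>z::complex^'n. c *s z"
  have L: "distr lborel borel ?L = lborel"
  proof (rule lborel_distr_linear_isometry)
    show "linear ?L" by (rule linearI) (simp_all add: vec_eq_iff algebra_simps)
    show "norm (?L z) = norm z" for z using c by (simp add: norm_vec_def norm_mult)
    have "c \<noteq> 0" using c by auto
    then have "?L (inverse c *s z) = z" for z by (simp add: vec_eq_iff)
    then show "surj ?L" by (rule surjI)
  qed
  have rp: "radproj blk (?L z) = ?L (radproj blk z)" for z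
    using c by (simp add: radproj_def blk_norm2_scale vec_eq_iff)
  have D: "?L z \<in> prod_ball blk \<longleftrightarrow> z \<in> prod_ball blk" for z
    using c by (simp add: prod_ball_def blk_norm2_scale)
  have "(\<integral>\<^sup>+z. g (radproj blk z) * indicator (prod_ball blk) z \<partial>lborel)
      = (\<integral>\<^sup>+z. g (radproj blk (?L z)) * indicator (prod_ball blk) (?L z) \<partial>lborel)"
    by (subst L[symmetric], subst nn_integral_distr) auto
  then show ?thesis
    by (simp add: nn_integral_bd_measure rp D indicator_def)
qed

text \<open>The bridge from the boundary to slices: after Tonelli, rotation invariance makes the
  inner integral independent of \<open>t\<close>.\<close>

lemma nn_integral_bd_measure_circle:
  fixes blk :: "'n::finite \<Rightarrow> 'k::finite"
  assumes [measurable]: "g \<in> borel_measurable borel"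
  shows "(\<integral>\<^sup>+\<zeta>. \<integral>\<^sup>+t. g (ecirc t *s \<zeta>) \<partial>unif01 \<partial>bd_measure blk) = (\<integral>\<^sup>+\<zeta>. g \<zeta> \<partial>bd_measure blk)"
proof -
  interpret finite_measure "bd_measure blk" by (rule finite_measure_bd_measure)
  interpret pair_sigma_finite "bd_measure blk" unif01 ..
  have "(\<integral>\<^sup>+\<zeta>. \<integral>\<^sup>+t. g (ecirc t *s \<zeta>) \<partial>unif01 \<partial>bd_measure blk) = (\<integral>\<^sup>+t. \<integral>\<^sup>+\<zeta>. g (ecirc t *s \<zeta>) \<partial>bd_measure blk \<partial>unif01)"
    by (rule Fubini'[symmetric]) measurable
  then show ?thesis by (simp add: nn_integral_bd_measure_rotate)
qed

section \<open>Slices through boundary points\<close>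

lemma vec_scale_in_prod_ball:
  assumes "\<zeta> \<in> dist_bdry blk" "cmod c < 1"
  shows "c *s \<zeta> \<in> prod_ball blk"
  using assms by (simp add: dist_bdry_def prod_ball_def blk_norm2_scale power_less_one_iff abs_square_less_1)

lemma vec_scale_in_dist_bdry:
  assumes "\<zeta> \<in> dist_bdry blk" "cmod c = 1"
  shows "c *s \<zeta> \<in> dist_bdry blk"
  using assms by (simp add: dist_bdry_def blk_norm2_scale)

text \<open>The chain rule gives the real derivative \<open>f' (h *s \<zeta>)\<close> in direction
  \<open>h\<close>; complex homogeneity turns it into multiplication by
  \<open>f' \<zeta>\<close>.\<close>

lemma holo_on_slice:
  fixes f :: "complex^'n::finite \<Rightarrow> complex"
  assumes "holo_on (prod_ball blk) f" "\<zeta> \<in> dist_bdry blk"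
  shows "(\<lambda>c. f (c *s \<zeta>)) holomorphic_on ball 0 1"
proof (rule holomorphic_onI)
  fix c :: complex assume "c \<in> ball 0 1"
  then have "c *s \<zeta> \<in> prod_ball blk" using assms(2) by (intro vec_scale_in_prod_ball) auto
  then obtain f' where f': "(f has_derivative f') (at (c *s \<zeta>))" "\<And>c v. f' (c *s v) = c * f' v"
    using assms(1) by (auto simp: holo_on_def)
  have "linear (\<lambda>h. h *s \<zeta>)" by (rule linearI) (simp_all add: vec_eq_iff algebra_simps)
  then have "((\<lambda>h. h *s \<zeta>) has_derivative (\<lambda>h. h *s \<zeta>)) (at c)"
    by (intro bounded_linear_imp_has_derivative) (simp add: linear_conv_bounded_linear)
  from has_derivative_compose[OF this f'(1)]
  have "((\<lambda>c. f (c *s \<zeta>)) has_field_derivative f' \<zeta>) (at c)"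
    by (simp add: has_field_derivative_def f'(2) mult_commute_abs)
  then show "(\<lambda>c. f (c *s \<zeta>)) field_differentiable at c within ball 0 1"
    by (auto simp: field_differentiable_def intro: has_field_derivative_at_within)
qed

lemma holo_on_measurable:
  fixes f :: "complex^'n::finite \<Rightarrow> complex" and blk :: "'n \<Rightarrow> 'k::finite"
  assumes "holo_on (prod_ball blk) f"
  shows "(\<lambda>z. if z \<in> prod_ball blk then f z else 0) \<in> borel_measurable borel"
proof (rule borel_measurable_continuous_on_if)
  show "continuous_on (prod_ball blk) f"
    using assms unfolding holo_on_def
    by (intro continuous_at_imp_continuous_on ballI) (blast intro: has_derivative_continuous)
qed (auto intro: continuous_intros)

section \<open>Boundary values of Hardy functions on products of balls\<close>

text \<open>All quantifiers on the right range over countable sets, so convergence becomes a Borel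
  condition. The inequality there is not strict, so that it survives the passage from rational to
  real radii.\<close>

lemma tendsto_at_left_1_iff_rat:
  fixes g :: "real \<Rightarrow> 'a::metric_space"
  assumes cont: "continuous_on {0..<1} g"
  shows "(g \<longlongrightarrow> l) (at_left 1) \<longleftrightarrow>
    (\<forall>m. \<exists>k. \<forall>q::rat. rad k < of_rat q \<longrightarrow> of_rat q < (1::real) \<longrightarrow> dist (g (of_rat q)) l \<le> inverse (real (Suc m)))"
proof (intro iffI allI)
  fix m assume "(g \<longlongrightarrow> l) (at_left 1)"
  then have "eventually (\<lambda>r. dist (g r) l < inverse (real (Suc m))) (at_left 1)"
    by (rule tendstoD) simp
  then obtain d where d: "d < 1" "\<And>r. d < r \<Longrightarrow> r < 1 \<Longrightarrow> dist (g r) l < inverse (real (Suc m))"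
    unfolding eventually_at_left_field by blast
  obtain k where "d < rad k"
    using order_tendstoD(1)[OF rad_tendsto d(1)] by (auto simp: eventually_sequentially)
  then show "\<exists>k. \<forall>q::rat. rad k < of_rat q \<longrightarrow> of_rat q < (1::real) \<longrightarrow> dist (g (of_rat q)) l \<le> inverse (real (Suc m))"
    using d(2) by (meson less_imp_le less_trans)
next
  assume rat: "\<forall>m. \<exists>k. \<forall>q::rat. rad k < of_rat q \<longrightarrow> of_rat q < (1::real) \<longrightarrow> dist (g (of_rat q)) l \<le> inverse (real (Suc m))"
  show "(g \<longlongrightarrow> l) (at_left 1)"
  proof (rule tendstoI)
    fix e :: real assume "0 < e"
    then obtain m where m: "inverse (real (Suc m)) < e" using reals_Archimedean by blast
    obtain k where k: "\<And>q::rat. rad k < of_rat q \<Longrightarrow> of_rat q < (1::real) \<Longrightarrow> dist (g (of_rat q)) l \<le> inverse (real (Suc m))"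
      using rat by blast
    show "eventually (\<lambda>r. dist (g r) l < e) (at_left 1)"
      unfolding eventually_at_left_field
    proof (intro exI[of _ "rad k"] conjI allI impI rad_bounds)
      fix r assume r: "rad k < r" "r < 1"
      \<comment> \<open>Approximation from above keeps the rational radii beyond
        \<open>rad k\<close>.\<close>
      have "\<exists>q::rat. r < of_rat q \<and> of_rat q < min 1 (r + inverse (real (Suc n)))" for n
        using of_rat_dense[of r "min 1 (r + inverse (real (Suc n)))"] r by auto
      then obtain q :: "nat \<Rightarrow> rat" where q: "\<And>n. r < of_rat (q n)" "\<And>n. of_rat (q n) < (1::real)"
          "\<And>n. of_rat (q n) < r + inverse (real (Suc n))"
        by (metis min_less_iff_conj)
      have "(\<lambda>n. real_of_rat (q n)) \<longlonglongrightarrow> r"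
        by (rule tendsto_sandwich[OF _ _ tendsto_const LIMSEQ_inverse_real_of_nat_add])
          (use q in \<open>auto intro!: always_eventually less_imp_le simp del: of_nat_Suc\<close>)
      moreover have r0: "0 \<le> r" using r rad_bounds[of k] by simp
      ultimately have "(\<lambda>n. g (of_rat (q n))) \<longlonglongrightarrow> g r"
        using r q less_imp_le[OF le_less_trans[OF r0 q(1)]]
        by (intro continuous_on_tendsto_compose[OF cont]) auto
      then have "(\<lambda>n. dist (g (of_rat (q n))) l) \<longlonglongrightarrow> dist (g r) l" by (intro tendsto_intros)
      then have "dist (g r) l \<le> inverse (real (Suc m))"
        by (rule LIMSEQ_le_const2) (use k q r less_trans in blast)
      then show "dist (g r) l < e" using m by simp
    qed
  qed
qed

text \<open>The hypothesis is a lower limit along \<open>rad\<close> because Fatou's lemma produces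
  it in that form. Each finite partial sum of the Parseval series at \<open>rad k\<close> lies below
  the mean, and letting \<open>k\<close> grow bounds the partial sums of the squared
  coefficients.\<close>

lemma hardy_parseval_summable:
  assumes f: "\<And>z. cmod z < 1 \<Longrightarrow> (\<lambda>n. a n * z ^ n) sums f z"
    and fin: "liminf (\<lambda>k. \<integral>\<^sup>+t. ennreal ((cmod (f (of_real (rad k) * ecirc t)))\<^sup>2) \<partial>unif01) \<noteq> \<infinity>"
  shows "summable (\<lambda>n. (cmod (a n))\<^sup>2)"
proof -
  let ?L = "liminf (\<lambda>k. \<integral>\<^sup>+t. ennreal ((cmod (f (of_real (rad k) * ecirc t)))\<^sup>2) \<partial>unif01)"
  obtain c where c: "?L = ennreal c" "0 \<le> c" using fin by (cases ?L) auto
  have "(\<Sum>n<N. (cmod (a n))\<^sup>2) \<le> c" for N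
  proof -
    have "(\<lambda>k. \<Sum>n<N. (cmod (a n))\<^sup>2 * rad k ^ (2 * n)) \<longlonglongrightarrow> (\<Sum>n<N. (cmod (a n))\<^sup>2 * 1 ^ (2 * n))"
      by (intro tendsto_intros rad_tendsto)
    then have "(\<lambda>k. ennreal (\<Sum>n<N. (cmod (a n))\<^sup>2 * rad k ^ (2 * n))) \<longlonglongrightarrow> ennreal (\<Sum>n<N. (cmod (a n))\<^sup>2)"
      by (intro tendsto_ennrealI) simp
    then have "ennreal (\<Sum>n<N. (cmod (a n))\<^sup>2) = liminf (\<lambda>k. ennreal (\<Sum>n<N. (cmod (a n))\<^sup>2 * rad k ^ (2 * n)))"
      by (rule lim_imp_Liminf[symmetric, rotated]) simp
    also have "\<dots> \<le> ?L"
    proof (intro Liminf_mono always_eventually allI)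
      fix k
      have r: "0 \<le> rad k" "rad k < 1" using rad_bounds[of k] by auto
      have P: "(\<lambda>n. (cmod (a n))\<^sup>2 * rad k ^ (2 * n)) sums (LINT t|unif01. (cmod (f (of_real (rad k) * ecirc t)))\<^sup>2)"
        "integrable unif01 (\<lambda>t. (cmod (f (of_real (rad k) * ecirc t)))\<^sup>2)"
        using parseval[of a f "rad k"] f r by blast+
      have "(\<Sum>n<N. (cmod (a n))\<^sup>2 * rad k ^ (2 * n)) \<le> (LINT t|unif01. (cmod (f (of_real (rad k) * ecirc t)))\<^sup>2)"
        unfolding sums_unique[OF P(1)] using r by (intro sum_le_suminf sums_summable[OF P(1)]) auto
      then show "ennreal (\<Sum>n<N. (cmod (a n))\<^sup>2 * rad k ^ (2 * n)) \<le> (\<integral>\<^sup>+t. ennreal ((cmod (f (of_real (rad k) * ecirc t)))\<^sup>2) \<partial>unif01)"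
        by (subst nn_integral_eq_integral[OF P(2)]) (auto intro: ennreal_leI)
    qed
    finally show ?thesis using c by (simp add: c(1))
  qed
  then show ?thesis by (intro summableI_nonneg_bounded) auto
qed

text \<open>Outside the domain \<open>f\<close> is arbitrary; extension by zero makes it a Borel
  function on the whole space.\<close>

definition ext0 :: "('n::finite \<Rightarrow> 'k) \<Rightarrow> (complex^'n \<Rightarrow> complex) \<Rightarrow> complex^'n \<Rightarrow> complex" where
  "ext0 blk f z = (if z \<in> prod_ball blk then f z else 0)"

text \<open>A Borel function that agrees with \<^const>\<open>radial_bv\<close> at all boundary points where the radial
  limit exists; unlike it, it is a limit along a sequence of radii, so its measurability is clear.\<close>
definition borel_bv :: "('n::finite \<Rightarrow> 'k) \<Rightarrow> (complex^'n \<Rightarrow> complex) \<Rightarrow> complex^'n \<Rightarrow> complex" where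
  "borel_bv blk f \<zeta> = lim (\<lambda>k. ext0 blk f (rad k *\<^sub>R \<zeta>))"

lemma radial_bv_eqI:
  assumes "((\<lambda>r. f (r *\<^sub>R \<zeta>)) \<longlongrightarrow> l) (at_left 1)"
  shows "radial_bv f \<zeta> = l"
  using assms unfolding radial_bv_def by (intro tendsto_Lim) auto

lemma scaleR_in_prod_ball:
  assumes "\<zeta> \<in> dist_bdry blk" "0 \<le> r" "r < 1"
  shows "r *\<^sub>R \<zeta> \<in> prod_ball blk"
  unfolding scaleR_eq_vec_scale using assms by (intro vec_scale_in_prod_ball) auto

lemma ext0_scaleR:
  assumes "\<zeta> \<in> dist_bdry blk" "0 \<le> r" "r < 1"
  shows "ext0 blk f (r *\<^sub>R \<zeta>) = f (r *\<^sub>R \<zeta>)"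
  using scaleR_in_prod_ball[OF assms] by (simp add: ext0_def)

lemma borel_bv_eqI:
  assumes \<zeta>: "\<zeta> \<in> dist_bdry blk" and l: "((\<lambda>r. f (r *\<^sub>R \<zeta>)) \<longlongrightarrow> l) (at_left 1)"
  shows "borel_bv blk f \<zeta> = l"
  unfolding borel_bv_def using filterlim_compose[OF l filterlim_rad] rad_bounds
  by (simp add: limI ext0_scaleR[OF \<zeta>] less_imp_le)

context
  fixes blk :: "'n::finite \<Rightarrow> 'k::finite" and f :: "complex^'n \<Rightarrow> complex"
  assumes surj: "surj blk" and holo: "holo_on (prod_ball blk) f"
begin

lemma ext0_measurable [measurable]: "ext0 blk f \<in> borel_measurable borel"
  unfolding ext0_def using holo by (rule holo_on_measurable)

lemma borel_bv_measurable [measurable]: "borel_bv blk f \<in> borel_measurable borel"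
  unfolding borel_bv_def by measurable

text \<open>Convergence ranges over uncountably many radii and, off the distinguished boundary, over
  unspecified values of \<open>f\<close>. Rational radii and \<open>ext0\<close> give a Borel
  predicate that agrees with it on that boundary.\<close>

lemma borel_bv_tendsto_predicate:
  obtains P where "Measurable.pred borel P"
    "\<And>\<zeta>. \<zeta> \<in> dist_bdry blk \<Longrightarrow> P \<zeta> \<longleftrightarrow> ((\<lambda>r. f (r *\<^sub>R \<zeta>)) \<longlongrightarrow> borel_bv blk f \<zeta>) (at_left 1)"
proof
  define P where "P \<zeta> \<longleftrightarrow> (\<forall>m. \<exists>k. \<forall>q::rat. rad k < of_rat q \<longrightarrow> of_rat q < (1::real) \<longrightarrow>
      dist (ext0 blk f (real_of_rat q *\<^sub>R \<zeta>)) (borel_bv blk f \<zeta>) \<le> inverse (real (Suc m)))" for \<zeta>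
  show "Measurable.pred borel P"
    unfolding P_def by measurable
  fix \<zeta> assume \<zeta>: "\<zeta> \<in> dist_bdry blk"
  have "continuous_on {0..<1} (\<lambda>r. f (of_real r *s \<zeta>))"
    by (rule continuous_on_compose2[OF holomorphic_on_imp_continuous_on[OF holo_on_slice[OF holo \<zeta>]]])
      (auto intro: continuous_intros)
  then have "continuous_on {0..<1} (\<lambda>r. f (r *\<^sub>R \<zeta>))" by (simp add: scaleR_eq_vec_scale)
  note iff = tendsto_at_left_1_iff_rat[OF this]
  have ext: "ext0 blk f (real_of_rat q *\<^sub>R \<zeta>) = f (real_of_rat q *\<^sub>R \<zeta>)" if "rad k < of_rat q" "of_rat q < (1::real)" for k q
  proof -
    have "0 \<le> real_of_rat q" using that rad_bounds[of k] by linarith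
    then show ?thesis using that(2) by (rule ext0_scaleR[OF \<zeta>])
  qed
  show "P \<zeta> \<longleftrightarrow> ((\<lambda>r. f (r *\<^sub>R \<zeta>)) \<longlongrightarrow> borel_bv blk f \<zeta>) (at_left 1)"
    unfolding iff P_def by (intro iff_allI iff_exI imp_cong refl) (metis ext)
qed

text \<open>The means of the slices integrate to the means of \<open>f\<close>, which the Hardy norm
  bounds. By Fatou almost every slice has a finite lower limit of means along \<open>rad\<close>, so
  its Taylor coefficients are square summable and the results on the disc apply.\<close>

lemma AE_slice_radial_limit:
  assumes H: "hardy_norm2 blk f < \<infinity>"
  shows "AE \<zeta> in bd_measure blk. \<zeta> \<in> dist_bdry blk \<and>
     (AE t in unif01. ((\<lambda>r. f (r *\<^sub>R (ecirc t *s \<zeta>))) \<longlongrightarrow> borel_bv blk f (ecirc t *s \<zeta>)) (at_left 1)) \<and>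
     (\<forall>r. 0 < r \<and> r < 1 \<longrightarrow> (\<integral>\<^sup>+t. ennreal ((cmod (ext0 blk f (r *\<^sub>R (ecirc t *s \<zeta>))))\<^sup>2) \<partial>unif01)
          \<le> (\<integral>\<^sup>+t. ennreal ((cmod (borel_bv blk f (ecirc t *s \<zeta>)))\<^sup>2) \<partial>unif01))"
proof -
  let ?\<Phi> = "\<lambda>r \<zeta>. \<integral>\<^sup>+t. ennreal ((cmod (ext0 blk f (r *\<^sub>R (ecirc t *s \<zeta>))))\<^sup>2) \<partial>unif01"
  have le_H: "(\<integral>\<^sup>+\<zeta>. ?\<Phi> (rad k) \<zeta> \<partial>bd_measure blk) \<le> hardy_norm2 blk f" for k
  proof -
    have "(\<integral>\<^sup>+\<zeta>. ?\<Phi> (rad k) \<zeta> \<partial>bd_measure blk) = (\<integral>\<^sup>+\<zeta>. ennreal ((cmod (ext0 blk f (rad k *\<^sub>R \<zeta>)))\<^sup>2) \<partial>bd_measure blk)"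
      by (rule nn_integral_bd_measure_circle[where g="\<lambda>\<zeta>. ennreal ((cmod (ext0 blk f (rad k *\<^sub>R \<zeta>)))\<^sup>2)"]) measurable
    also have "\<dots> = (\<integral>\<^sup>+\<zeta>. ennreal ((cmod (f (rad k *\<^sub>R \<zeta>)))\<^sup>2) \<partial>Sigma_bd blk)"
      unfolding Sigma_bd_eq nn_integral_completion
      using AE_bd_measure_dist_bdry[OF surj] rad_bounds[of k]
      by (intro nn_integral_cong_AE) (auto elim!: eventually_mono simp: ext0_scaleR)
    also have "\<dots> \<le> hardy_norm2 blk f"
      unfolding hardy_norm2_def using rad_bounds[of k] by (intro SUP_upper) auto
    finally show ?thesis .
  qed
  have [measurable]: "?\<Phi> (rad k) \<in> borel_measurable (bd_measure blk)" for k by measurable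
  have "(\<integral>\<^sup>+\<zeta>. liminf (\<lambda>k. ?\<Phi> (rad k) \<zeta>) \<partial>bd_measure blk) \<le> liminf (\<lambda>k. \<integral>\<^sup>+\<zeta>. ?\<Phi> (rad k) \<zeta> \<partial>bd_measure blk)"
    by (rule nn_integral_liminf) measurable
  also have "\<dots> \<le> liminf (\<lambda>k. hardy_norm2 blk f)"
    by (intro Liminf_mono always_eventually allI le_H)
  also have "\<dots> < \<infinity>" using H by (simp add: Liminf_const)
  finally have "AE \<zeta> in bd_measure blk. liminf (\<lambda>k. ?\<Phi> (rad k) \<zeta>) \<noteq> \<infinity>"
    by (intro nn_integral_noteq_infinite) auto
  then show ?thesis
    using AE_bd_measure_dist_bdry[OF surj]
  proof eventually_elim
    case (elim \<zeta>)
    note \<zeta> = elim(2)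
    define g where "g c = f (c *s \<zeta>)" for c
    define a where "a n = (deriv ^^ n) g 0 / fact n" for n
    have sums: "(\<lambda>n. a n * z ^ n) sums g z" if "cmod z < 1" for z
      using holomorphic_power_series[OF holo_on_slice[OF holo \<zeta>], of z] that
      by (simp add: a_def g_def[abs_def])
    have rot: "ecirc t *s \<zeta> \<in> dist_bdry blk" for t using \<zeta> by (intro vec_scale_in_dist_bdry) auto
    have fg: "f (r *\<^sub>R (ecirc t *s \<zeta>)) = g (of_real r * ecirc t)" for r t
      by (simp add: g_def scaleR_eq_vec_scale)
    have ext: "ext0 blk f (r *\<^sub>R (ecirc t *s \<zeta>)) = g (of_real r * ecirc t)" if "0 < r" "r < 1" for r t
      using that by (subst ext0_scaleR[OF rot]) (auto simp: fg)
    have a: "summable (\<lambda>n. (cmod (a n))\<^sup>2)"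
      using elim(1) by (intro hardy_parseval_summable[OF sums]) (simp_all add: ext rad_bounds)
    have 1: "AE t in unif01. ((\<lambda>r. g (of_real r * ecirc t)) \<longlongrightarrow> borel_bv blk f (ecirc t *s \<zeta>)) (at_left 1)"
    proof -
      have "AE t in unif01. \<exists>l. ((\<lambda>r. g (of_real r * ecirc t)) \<longlongrightarrow> l) (at_left 1)"
        using sums a by (rule hardy_radial_limit)
      then show ?thesis
      proof eventually_elim
      case (elim t)
      then obtain l where l: "((\<lambda>r. f (r *\<^sub>R (ecirc t *s \<zeta>))) \<longlongrightarrow> l) (at_left 1)" by (auto simp: fg)
      then show ?case using borel_bv_eqI[OF rot l] by (simp add: fg)
      qed
    qed
    have "(\<integral>\<^sup>+t. ennreal ((cmod (g (of_real r * ecirc t)))\<^sup>2) \<partial>unif01)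
          \<le> (\<integral>\<^sup>+t. ennreal ((cmod (borel_bv blk f (ecirc t *s \<zeta>)))\<^sup>2) \<partial>unif01)" if "0 < r" "r < 1" for r
    proof (rule hardy_norm_le_boundary[OF _ a _ 1])
      show "(\<lambda>n. a n * z ^ n) sums g z" if "cmod z < 1" for z using that by (rule sums)
    qed (use that in auto)
    then show ?case using \<zeta> 1 by (simp add: fg ext)
  qed
qed

text \<open>The indicator \<open>u\<close> of failure vanishes for almost every \<open>t\<close> on
  almost every slice; averaging over circles shows that its integral is zero.\<close>

lemma AE_radial_limit:
  assumes H: "hardy_norm2 blk f < \<infinity>"
  shows "AE \<zeta> in bd_measure blk. ((\<lambda>r. f (r *\<^sub>R \<zeta>)) \<longlongrightarrow> borel_bv blk f \<zeta>) (at_left 1)"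
proof -
  obtain P where [measurable]: "Measurable.pred borel P" and
    P: "\<And>\<zeta>. \<zeta> \<in> dist_bdry blk \<Longrightarrow> P \<zeta> \<longleftrightarrow> ((\<lambda>r. f (r *\<^sub>R \<zeta>)) \<longlongrightarrow> borel_bv blk f \<zeta>) (at_left 1)"
    using borel_bv_tendsto_predicate by blast
  define u :: "complex^'n \<Rightarrow> ennreal" where "u \<zeta> = (if P \<zeta> then 0 else 1)" for \<zeta>
  have [measurable]: "u \<in> borel_measurable borel" unfolding u_def by measurable
  have "AE \<zeta> in bd_measure blk. (\<integral>\<^sup>+t. u (ecirc t *s \<zeta>) \<partial>unif01) = 0"
    using AE_slice_radial_limit[OF H]
  proof eventually_elim
    case (elim \<zeta>)
    then have rot: "ecirc t *s \<zeta> \<in> dist_bdry blk" for t by (intro vec_scale_in_dist_bdry) auto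
    have "AE t in unif01. u (ecirc t *s \<zeta>) = 0"
      using conjunct1[OF conjunct2[OF elim]] by eventually_elim (simp add: u_def P[OF rot])
    then show ?case by (subst nn_integral_0_iff_AE) auto
  qed
  then have "(\<integral>\<^sup>+\<zeta>. \<integral>\<^sup>+t. u (ecirc t *s \<zeta>) \<partial>unif01 \<partial>bd_measure blk) = 0"
    by (subst nn_integral_0_iff_AE) auto
  then have "(\<integral>\<^sup>+\<zeta>. u \<zeta> \<partial>bd_measure blk) = 0"
    by (simp add: nn_integral_bd_measure_circle)
  then have "AE \<zeta> in bd_measure blk. u \<zeta> = 0"
    by (subst (asm) nn_integral_0_iff_AE) auto
  then show ?thesis
    using AE_bd_measure_dist_bdry[OF surj]
    by eventually_elim (auto simp: u_def P split: if_splits)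
qed

text \<open>Averaging over circles splits the mean at each radius into slice means, which the disc
  case bounds by slice boundary integrals.\<close>

lemma hardy_norm2_le_boundary:
  assumes H: "hardy_norm2 blk f < \<infinity>"
  shows "hardy_norm2 blk f \<le> (\<integral>\<^sup>+\<zeta>. ennreal ((cmod (borel_bv blk f \<zeta>))\<^sup>2) \<partial>bd_measure blk)"
  unfolding hardy_norm2_def
proof (rule SUP_least)
  fix r :: real assume r: "r \<in> {0<..<1}"
  have "(\<integral>\<^sup>+\<zeta>. ennreal ((cmod (f (r *\<^sub>R \<zeta>)))\<^sup>2) \<partial>Sigma_bd blk)
      = (\<integral>\<^sup>+\<zeta>. ennreal ((cmod (ext0 blk f (r *\<^sub>R \<zeta>)))\<^sup>2) \<partial>bd_measure blk)"
    unfolding Sigma_bd_eq nn_integral_completion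
    using AE_bd_measure_dist_bdry[OF surj] r
    by (intro nn_integral_cong_AE) (auto elim!: eventually_mono simp: ext0_scaleR)
  also have "\<dots> = (\<integral>\<^sup>+\<zeta>. \<integral>\<^sup>+t. ennreal ((cmod (ext0 blk f (r *\<^sub>R (ecirc t *s \<zeta>))))\<^sup>2) \<partial>unif01 \<partial>bd_measure blk)"
    by (rule nn_integral_bd_measure_circle[where g="\<lambda>\<zeta>. ennreal ((cmod (ext0 blk f (r *\<^sub>R \<zeta>)))\<^sup>2)", symmetric]) measurable
  also have "\<dots> \<le> (\<integral>\<^sup>+\<zeta>. \<integral>\<^sup>+t. ennreal ((cmod (borel_bv blk f (ecirc t *s \<zeta>)))\<^sup>2) \<partial>unif01 \<partial>bd_measure blk)"
  proof (rule nn_integral_mono_AE)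
    show "AE \<zeta> in bd_measure blk. (\<integral>\<^sup>+t. ennreal ((cmod (ext0 blk f (r *\<^sub>R (ecirc t *s \<zeta>))))\<^sup>2) \<partial>unif01)
        \<le> (\<integral>\<^sup>+t. ennreal ((cmod (borel_bv blk f (ecirc t *s \<zeta>)))\<^sup>2) \<partial>unif01)"
      using AE_slice_radial_limit[OF H] by eventually_elim (use r in auto)
  qed
  also have "\<dots> = (\<integral>\<^sup>+\<zeta>. ennreal ((cmod (borel_bv blk f \<zeta>))\<^sup>2) \<partial>bd_measure blk)"
    by (rule nn_integral_bd_measure_circle[where g="\<lambda>\<zeta>. ennreal ((cmod (borel_bv blk f \<zeta>))\<^sup>2)"]) measurable
  finally show "(\<integral>\<^sup>+\<zeta>. ennreal ((cmod (f (r *\<^sub>R \<zeta>)))\<^sup>2) \<partial>Sigma_bd blk)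
      \<le> (\<integral>\<^sup>+\<zeta>. ennreal ((cmod (borel_bv blk f \<zeta>))\<^sup>2) \<partial>bd_measure blk)" .
qed

text \<open>Fatou's lemma along \<open>rad\<close>, since the boundary value is almost everywhere
  the limit there.\<close>

lemma boundary_norm_finite:
  assumes H: "hardy_norm2 blk f < \<infinity>"
  shows "(\<integral>\<^sup>+\<zeta>. ennreal ((cmod (borel_bv blk f \<zeta>))\<^sup>2) \<partial>bd_measure blk) < \<infinity>"
proof -
  let ?u = "\<lambda>k \<zeta>. ennreal ((cmod (ext0 blk f (rad k *\<^sub>R \<zeta>)))\<^sup>2)"
  have lim: "AE \<zeta> in bd_measure blk. ennreal ((cmod (borel_bv blk f \<zeta>))\<^sup>2) = liminf (\<lambda>k. ?u k \<zeta>)"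
    using AE_radial_limit[OF H] AE_bd_measure_dist_bdry[OF surj]
  proof eventually_elim
    case (elim \<zeta>)
    have "(\<lambda>k. ennreal ((cmod (f (rad k *\<^sub>R \<zeta>)))\<^sup>2)) \<longlonglongrightarrow> ennreal ((cmod (borel_bv blk f \<zeta>))\<^sup>2)"
      by (intro tendsto_ennrealI tendsto_intros filterlim_compose[OF elim(1) filterlim_rad])
    then have "(\<lambda>k. ?u k \<zeta>) \<longlonglongrightarrow> ennreal ((cmod (borel_bv blk f \<zeta>))\<^sup>2)"
      using rad_bounds by (simp add: ext0_scaleR[OF elim(2)] less_imp_le)
    then show ?case by (rule lim_imp_Liminf[symmetric, rotated]) simp
  qed
  have "(\<integral>\<^sup>+\<zeta>. ennreal ((cmod (borel_bv blk f \<zeta>))\<^sup>2) \<partial>bd_measure blk) = (\<integral>\<^sup>+\<zeta>. liminf (\<lambda>k. ?u k \<zeta>) \<partial>bd_measure blk)"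
    using lim by (rule nn_integral_cong_AE)
  also have "\<dots> \<le> liminf (\<lambda>k. \<integral>\<^sup>+\<zeta>. ?u k \<zeta> \<partial>bd_measure blk)"
    by (rule nn_integral_liminf) measurable
  also have "\<dots> \<le> liminf (\<lambda>k. hardy_norm2 blk f)"
  proof (intro Liminf_mono always_eventually allI)
    fix k
    have "(\<integral>\<^sup>+\<zeta>. ?u k \<zeta> \<partial>bd_measure blk) = (\<integral>\<^sup>+\<zeta>. ennreal ((cmod (f (rad k *\<^sub>R \<zeta>)))\<^sup>2) \<partial>Sigma_bd blk)"
      unfolding Sigma_bd_eq nn_integral_completion
      using AE_bd_measure_dist_bdry[OF surj] rad_bounds[of k]
      by (intro nn_integral_cong_AE) (auto elim!: eventually_mono simp: ext0_scaleR)
    also have "\<dots> \<le> hardy_norm2 blk f"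
      unfolding hardy_norm2_def using rad_bounds[of k] by (intro SUP_upper) auto
    finally show "(\<integral>\<^sup>+\<zeta>. ?u k \<zeta> \<partial>bd_measure blk) \<le> hardy_norm2 blk f" .
  qed
  also have "\<dots> < \<infinity>" using H by (simp add: Liminf_const)
  finally show ?thesis .
qed

end

section \<open>Dominant sets\<close>

text \<open>Serves integrands built from \<open>radial_bv\<close>, whose values are unspecified
  where no limit exists: almost everywhere agreement with a Borel function suffices in the
  completion.\<close>

lemma borel_measurable_completion_AE:
  fixes g h :: "'a \<Rightarrow> 'b::topological_space"
  assumes [measurable]: "g \<in> borel_measurable M" and ae: "AE x in M. h x = g x"
  shows "h \<in> borel_measurable (completion M)"
proof (rule borel_measurableI)
  fix S :: "'b set" assume "open S"
  show "h -` S \<inter> space (completion M) \<in> sets (completion M)"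
  proof (rule completion.in_sets_AE)
    have "g -` S \<inter> space M \<in> sets M"
      using assms(1) \<open>open S\<close> by (intro measurable_sets[where A=borel]) auto
    then show "g -` S \<inter> space M \<in> sets (completion M)" by (rule sets_completionI_sets)
    show "AE x in completion M. x \<in> g -` S \<inter> space M \<longleftrightarrow> x \<in> h -` S \<inter> space (completion M)"
      using AE_completion[OF ae] by eventually_elim simp
  qed simp
qed

lemma cnj_measurable [measurable]: "cnj \<in> borel_measurable borel"
  by (intro borel_measurable_continuous_onI continuous_intros)

theorem theorem1p1:
  fixes blk :: "'n::finite \<Rightarrow> 'k::finite" and I :: "complex^'n \<Rightarrow> complex"
  assumes "surj blk"
    and "inner_fun blk I"
  shows "\<exists>E C. E \<in> sets (Sigma_bd blk) \<and> E \<subseteq> dist_bdry blk \<and> emeasure (Sigma_bd blk) E < 1 \<and>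
           C > (0::real) \<and>
           (\<forall>f \<in> model_space blk I.
              hardy_norm2 blk f \<le> ennreal C * (\<integral>\<^sup>+ \<zeta>\<in>E. ennreal ((cmod (radial_bv f \<zeta>))^2) \<partial>Sigma_bd blk))"
proof -
  let ?M = "bd_measure blk"
  interpret finite_measure ?M by (rule finite_measure_bd_measure)
  note bdry = AE_bd_measure_dist_bdry[OF \<open>surj blk\<close>]

  \<comment> \<open>Boundary values of the inner function and choice of the set\<close>
  define b where "b = borel_bv blk I"
  have [measurable]: "b \<in> borel_measurable borel"
    unfolding b_def using assms by (intro borel_bv_measurable) (simp_all add: inner_fun_def)
  have I: "AE \<zeta> in ?M. ((\<lambda>r. I (r *\<^sub>R \<zeta>)) \<longlongrightarrow> b \<zeta>) (at_left 1) \<and> cmod (b \<zeta>) = 1"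
  proof -
    have "AE \<zeta> in ?M. \<exists>w. ((\<lambda>r. I (r *\<^sub>R \<zeta>)) \<longlongrightarrow> w) (at_left 1) \<and> cmod w = 1"
      using assms(2) unfolding inner_fun_def Sigma_bd_eq AE_completion_iff by blast
    then show ?thesis using bdry
    proof eventually_elim
      case (elim \<zeta>)
      then obtain w where w: "((\<lambda>r. I (r *\<^sub>R \<zeta>)) \<longlongrightarrow> w) (at_left 1)" "cmod w = 1" by blast
      moreover have "b \<zeta> = w" unfolding b_def by (rule borel_bv_eqI[OF elim(2) w(1)])
      ultimately show ?case by simp
    qed
  qed
  \<comment> \<open>A level \<open>- t\<close> with \<open>t > 0\<close> and
    \<open>2 * t^2 < 1\<close> serves two ends: \<open>- Re (c * b \<zeta>) / t\<close> exceeds 1 on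
    the rest of the boundary, and four sets of full measure would force
    \<open>(cmod (b \<zeta>))^2 \<le> 2 * t^2 < 1\<close>. The final constant is
    \<open>1 + 1 / t = 3\<close>.\<close>
  define E where "E c = {\<zeta> \<in> dist_bdry blk. - 1 / 2 \<le> Re (c * b \<zeta>)}" for c
  have [measurable]: "E c \<in> sets borel" for c
    unfolding E_def by measurable
  have "\<exists>c\<in>{1, -1, \<i>, -\<i>}. emeasure ?M (E c) < 1"
  proof (rule ccontr)
    assume neg: "\<not> ?thesis"
    have "AE \<zeta> in ?M. \<zeta> \<in> E c" if "c \<in> {1, -1, \<i>, -\<i>}" for c
    proof (rule AE_I)
      have "emeasure ?M (UNIV - E c) = emeasure ?M UNIV - emeasure ?M (E c)"
        by (intro emeasure_Diff) auto
      also have "\<dots> = 0"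
      proof -
        have "1 \<le> emeasure ?M (E c)" using neg that by (simp only: Bex_def not_ex not_less de_Morgan_conj) blast
        then show ?thesis by (simp add: prob_bd_measure diff_eq_0_iff_ennreal)
      qed
      finally show "emeasure ?M (UNIV - E c) = 0" .
    qed auto
    then have "AE \<zeta> in ?M. \<zeta> \<in> E 1" "AE \<zeta> in ?M. \<zeta> \<in> E (-1)" "AE \<zeta> in ?M. \<zeta> \<in> E \<i>" "AE \<zeta> in ?M. \<zeta> \<in> E (-\<i>)"
      by simp_all
    then have "AE \<zeta> in ?M. False"
      using I
    proof eventually_elim
      case (elim \<zeta>)
      \<comment> \<open>The constants 1 and -1 bound the real part from both sides,
        \<open>\<i>\<close> and \<open>-\<i>\<close> the imaginary part.\<close>
      then have "\<bar>Re (b \<zeta>)\<bar> \<le> 1/2 \<and> \<bar>Im (b \<zeta>)\<bar> \<le> 1/2" unfolding E_def mem_Collect_eq by simp linarith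
      then have "\<bar>Re (b \<zeta>)\<bar> \<le> 1/2" "\<bar>Im (b \<zeta>)\<bar> \<le> 1/2" by blast+
      then have "\<bar>Re (b \<zeta>)\<bar>\<^sup>2 \<le> (1/2)\<^sup>2" "\<bar>Im (b \<zeta>)\<bar>\<^sup>2 \<le> (1/2)\<^sup>2" by (simp_all only: power_mono abs_ge_zero)
      then have "(cmod (b \<zeta>))\<^sup>2 \<le> (1/2)\<^sup>2 + (1/2)\<^sup>2"
        unfolding cmod_power2 power2_abs by (rule add_mono)
      moreover have "cmod (b \<zeta>) = 1" using elim by simp
      ultimately show False by (simp add: power2_eq_square)
    qed
    then have "{\<zeta> \<in> space ?M. \<not> False} \<in> null_sets ?M"
      by (subst AE_iff_null[symmetric]) auto
    then show False by (auto simp: null_sets_def prob_bd_measure)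
  qed
  then obtain c where c: "c \<in> {1, -1, \<i>, -\<i>}" and Ec: "emeasure ?M (E c) < 1" by blast

  \<comment> \<open>The norm estimate on the model space\<close>
  have "hardy_norm2 blk f \<le> ennreal 3 * (\<integral>\<^sup>+ \<zeta>\<in>E c. ennreal ((cmod (radial_bv f \<zeta>))^2) \<partial>Sigma_bd blk)"
    if f: "f \<in> model_space blk I" for f
  proof -
    have holo: "holo_on (prod_ball blk) f" and fin: "hardy_norm2 blk f < \<infinity>"
      and orth: "H2_inner blk f (\<lambda>z. I z * f z) = 0"
      using f by (auto simp: model_space_def H2_def)
    define h where "h = borel_bv blk f"
    have [measurable]: "h \<in> borel_measurable borel"
      unfolding h_def by (rule borel_bv_measurable[OF \<open>surj blk\<close> holo])
    note lim = AE_radial_limit[OF \<open>surj blk\<close> holo fin, folded h_def]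
    have rad_f: "AE \<zeta> in ?M. radial_bv f \<zeta> = h \<zeta>"
      using lim by eventually_elim (rule radial_bv_eqI)
    have h2: "integrable ?M (\<lambda>\<zeta>. (cmod (h \<zeta>))\<^sup>2)"
      using boundary_norm_finite[OF \<open>surj blk\<close> holo fin, folded h_def] by (intro integrableI_nonneg) auto
    have int: "integrable ?M (\<lambda>\<zeta>. complex_of_real ((cmod (h \<zeta>))\<^sup>2) * cnj (b \<zeta>))"
    proof (rule Bochner_Integration.integrable_bound[OF h2])
      show "AE \<zeta> in ?M. norm (complex_of_real ((cmod (h \<zeta>))\<^sup>2) * cnj (b \<zeta>)) \<le> norm ((cmod (h \<zeta>))\<^sup>2)"
        using I by eventually_elim (simp add: norm_mult norm_power)
    qed measurable
    have "AE \<zeta> in ?M. radial_bv f \<zeta> * cnj (radial_bv (\<lambda>z. I z * f z) \<zeta>) = complex_of_real ((cmod (h \<zeta>))\<^sup>2) * cnj (b \<zeta>)"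
      using I lim
    proof eventually_elim
      case (elim \<zeta>)
      have "((\<lambda>r. I (r *\<^sub>R \<zeta>) * f (r *\<^sub>R \<zeta>)) \<longlongrightarrow> b \<zeta> * h \<zeta>) (at_left 1)"
        using elim by (intro tendsto_mult) auto
      then have "radial_bv (\<lambda>z. I z * f z) \<zeta> = b \<zeta> * h \<zeta>" by (rule radial_bv_eqI)
      moreover have "radial_bv f \<zeta> = h \<zeta>" using elim(2) by (rule radial_bv_eqI)
      ultimately show ?case by (simp only: complex_norm_square complex_cnj_mult mult_ac)
    qed
    note ae = this
    \<comment> \<open>The inner product lives on the completed measure; the integrand is replaced by
      a Borel one before the completion is dropped.\<close>
    have "0 = (LINT \<zeta>|completion ?M. radial_bv f \<zeta> * cnj (radial_bv (\<lambda>z. I z * f z) \<zeta>))"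
      using orth by (simp add: H2_inner_def Sigma_bd_eq)
    also have "\<dots> = (LINT \<zeta>|completion ?M. complex_of_real ((cmod (h \<zeta>))\<^sup>2) * cnj (b \<zeta>))"
    proof (rule integral_cong_AE)
      show "(\<lambda>\<zeta>. radial_bv f \<zeta> * cnj (radial_bv (\<lambda>z. I z * f z) \<zeta>)) \<in> borel_measurable (completion ?M)"
        by (rule borel_measurable_completion_AE[OF _ ae]) measurable
      show "(\<lambda>\<zeta>. complex_of_real ((cmod (h \<zeta>))\<^sup>2) * cnj (b \<zeta>)) \<in> borel_measurable (completion ?M)"
        by (rule measurable_completion) measurable
    qed (rule AE_completion[OF ae])
    also have "\<dots> = (LINT \<zeta>|?M. complex_of_real ((cmod (h \<zeta>))\<^sup>2) * cnj (b \<zeta>))"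
      by (intro integral_completion) measurable
    \<comment> \<open>As \<open>b \<zeta>\<close> occurs conjugated, \<open>c\<close> is conjugated
      too; the real part is then that of \<open>c * b \<zeta>\<close>.\<close>
    finally have "(LINT \<zeta>|?M. cnj c * (complex_of_real ((cmod (h \<zeta>))\<^sup>2) * cnj (b \<zeta>))) = 0"
      by simp
    then have "(LINT \<zeta>|?M. Re (cnj c * (complex_of_real ((cmod (h \<zeta>))\<^sup>2) * cnj (b \<zeta>)))) = 0"
      using int by (subst integral_Re) auto
    moreover have Re_eq: "Re (cnj c * (complex_of_real ((cmod (h \<zeta>))\<^sup>2) * cnj (b \<zeta>))) = (cmod (h \<zeta>))\<^sup>2 * Re (c * b \<zeta>)" for \<zeta>
      by (simp add: algebra_simps)
    ultimately have zero: "(LINT \<zeta>|?M. (cmod (h \<zeta>))\<^sup>2 * Re (c * b \<zeta>)) = 0" by simp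
    have int': "integrable ?M (\<lambda>\<zeta>. (cmod (h \<zeta>))\<^sup>2 * Re (c * b \<zeta>))"
      using integrable_Re[OF integrable_mult_right[OF int, of "cnj c"]] unfolding Re_eq by simp
    have intE: "integrable ?M (\<lambda>\<zeta>. (cmod (h \<zeta>))\<^sup>2 * indicator (E c) \<zeta>)"
      using h2 by (intro integrable_real_mult_indicator) auto
    have "(LINT \<zeta>|?M. (cmod (h \<zeta>))\<^sup>2)
        \<le> (LINT \<zeta>|?M. 3 * ((cmod (h \<zeta>))\<^sup>2 * indicator (E c) \<zeta>) - 2 * ((cmod (h \<zeta>))\<^sup>2 * Re (c * b \<zeta>)))"
    proof (rule integral_mono_AE)
      show "AE \<zeta> in ?M. (cmod (h \<zeta>))\<^sup>2 \<le> 3 * ((cmod (h \<zeta>))\<^sup>2 * indicator (E c) \<zeta>) - 2 * ((cmod (h \<zeta>))\<^sup>2 * Re (c * b \<zeta>))"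
        using I bdry
      proof eventually_elim
        case (elim \<zeta>)
        have "cmod c = 1" using c by auto
        then have "Re (c * b \<zeta>) \<le> 1"
          using elim complex_Re_le_cmod[of "c * b \<zeta>"] by (simp add: norm_mult)
        then have "1 \<le> 3 * indicator (E c) \<zeta> - 2 * Re (c * b \<zeta>)"
          using elim(2) by (auto simp: E_def indicator_def)
        from mult_left_mono[OF this, of "(cmod (h \<zeta>))\<^sup>2"] show ?case by (simp add: algebra_simps)
      qed
    qed (use h2 int' intE in auto)
    also have "\<dots> = 3 * (LINT \<zeta>|?M. (cmod (h \<zeta>))\<^sup>2 * indicator (E c) \<zeta>)"
      using int' intE zero by simp
    finally have "ennreal (LINT \<zeta>|?M. (cmod (h \<zeta>))\<^sup>2) \<le> ennreal (3 * (LINT \<zeta>|?M. (cmod (h \<zeta>))\<^sup>2 * indicator (E c) \<zeta>))"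
      by (rule ennreal_leI)
    also have "\<dots> = ennreal 3 * ennreal (LINT \<zeta>|?M. (cmod (h \<zeta>))\<^sup>2 * indicator (E c) \<zeta>)"
      by (rule ennreal_mult') simp
    finally have "ennreal (LINT \<zeta>|?M. (cmod (h \<zeta>))\<^sup>2) \<le> ennreal 3 * ennreal (LINT \<zeta>|?M. (cmod (h \<zeta>))\<^sup>2 * indicator (E c) \<zeta>)" .
    then have "(\<integral>\<^sup>+\<zeta>. ennreal ((cmod (h \<zeta>))\<^sup>2) \<partial>?M) \<le> ennreal 3 * (\<integral>\<^sup>+\<zeta>. ennreal ((cmod (h \<zeta>))\<^sup>2 * indicator (E c) \<zeta>) \<partial>?M)"
      using h2 intE by (simp add: nn_integral_eq_integral)
    also have "(\<integral>\<^sup>+\<zeta>. ennreal ((cmod (h \<zeta>))\<^sup>2 * indicator (E c) \<zeta>) \<partial>?M)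
        = (\<integral>\<^sup>+ \<zeta>\<in>E c. ennreal ((cmod (radial_bv f \<zeta>))^2) \<partial>Sigma_bd blk)"
      unfolding Sigma_bd_eq nn_integral_completion
    proof (rule nn_integral_cong_AE)
      show "AE \<zeta> in ?M. ennreal ((cmod (h \<zeta>))\<^sup>2 * indicator (E c) \<zeta>)
          = ennreal ((cmod (radial_bv f \<zeta>))\<^sup>2) * indicator (E c) \<zeta>"
        using rad_f by eventually_elim (simp add: indicator_def)
    qed
    finally show ?thesis
      using hardy_norm2_le_boundary[OF \<open>surj blk\<close> holo fin] unfolding h_def by (rule order_trans[rotated])
  qed
  moreover have "E c \<in> sets (Sigma_bd blk)"
    unfolding Sigma_bd_eq by (intro sets_completionI_sets) simp
  moreover have "emeasure (Sigma_bd blk) (E c) < 1"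
    using Ec unfolding Sigma_bd_eq by (subst emeasure_completion) (auto intro: sets_completionI_sets)
  moreover have "E c \<subseteq> dist_bdry blk" by (auto simp: E_def)
  ultimately show ?thesis
    by (intro exI[of _ "E c"] exI[of _ "3::real"] conjI ballI zero_less_numeral)
qed

end
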